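(* Let $n\ge 12$ be an integer divisible by $6$, and let $I_n\subseteq \mathbb{C}[x,y,z]$ be the homogeneous defining (radical) ideal of the set $\mathcal{B}_n\subset\mathbb{P}^2_{\mathbb{C}}$ of triple points of the Böröczky configuration of size $n$. Then the Waldschmidt constant of $I_n$ is $$\widehat{\alpha}(I_n)=\frac{n}{3}.$$
   Context: Böröczky configuration. For a real number $\theta$ let $P_\theta=(\cos\theta,\sin\theta)$ be the point of the unit circle in $\mathbb{R}^2$ with angle $\theta$. For $n\ge 3$ and $0\le j\le n-1$, let $L_j$ be the line through $P_{2\pi j/n}$ and $P_{\pi-4\pi j/n}$ if these points are distinct, and the tangent line to the unit circle at $P_{2\pi j/n}$ if they coincide. Let $\mathcal{L}_n=\{L_j: 0\le j\le n-1\}$. A triple point is a point of the plane where exactly three lines of $\mathcal{L}_n$ meet; $\mathcal{B}_n$ denotes the set of triple points, viewed in $\mathbb{P}^2_{\mathbb{C}}$ via $(a,b)\mapsto[a:b:1]$. For a nonzero proper homogeneous ideal $J$ of a standard graded polynomial ring, $J^{(m)}$ is its $m$-th symbolic power (for the radical ideal of a finite set of points, $J^{(m)}$ is the ideal generated by the forms vanishing to order at least $m$ at every point), $\alpha(J^{(m)})$ is the smallest degree of a nonzero element of $J^{(m)}$, and the Waldschmidt constant is $\widehat{\alpha}(J)=\lim_{m\to\infty}\alpha(J^{(m)})/m=\inf_{m\ge 1}\alpha(J^{(m)})/m$. *)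

theory Defs
  imports "HOL-Analysis.Analysis" "HOL-Library.Poly_Mapping"
begin

section \<open>Ideals of a commutative ring\<close>

text \<open>Ideals are the submodules of the ring regarded as a module over itself.\<close>

global_interpretation ring_module: module "(*) :: 'a::comm_ring_1 \<Rightarrow> 'a \<Rightarrow> 'a"
  by standard (simp_all add: algebra_simps)

abbreviation is_ideal :: "'a::comm_ring_1 set \<Rightarrow> bool" where
  "is_ideal \<equiv> ring_module.subspace"

abbreviation ideal_generated :: "'a::comm_ring_1 set \<Rightarrow> 'a set" where
  "ideal_generated \<equiv> ring_module.span"

definition prime_ideal :: "'a::comm_ring_1 set \<Rightarrow> bool" where
  "prime_ideal P \<longleftrightarrow>
     is_ideal P \<and> P \<noteq> UNIV \<and> (\<forall>a b. a * b \<in> P \<longrightarrow> a \<in> P \<or> b \<in> P)"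

primrec ideal_power :: "'a::comm_ring_1 set \<Rightarrow> nat \<Rightarrow> 'a set" where
  "ideal_power J 0 = UNIV"
| "ideal_power J (Suc m) = ideal_generated {a * b | a b. a \<in> J \<and> b \<in> ideal_power J m}"

text \<open>The associated primes of \<open>R/J\<close>: prime ideals of the form \<open>J : f\<close>.\<close>

definition associated_primes :: "'a::comm_ring_1 set \<Rightarrow> 'a set set" where
  "associated_primes J = {P. prime_ideal P \<and> (\<exists>f. P = {r. r * f \<in> J})}"

text \<open>\<open>J\<^sup>(\<^sup>m\<^sup>) = \<Inter> (J\<^sup>m R\<^sub>P \<inter> R)\<close> over the associated primes \<open>P\<close> of \<open>J\<close>, where an element \<open>f\<close>
  lies in the contraction \<open>J\<^sup>m R\<^sub>P \<inter> R\<close> iff \<open>s f \<in> J\<^sup>m\<close> for some \<open>s \<notin> P\<close>.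
  For the radical ideal of a finite set of points this is the ideal generated by the forms vanishing
  to order at least \<open>m\<close> at each of the points.\<close>

definition symbolic_power :: "'a::comm_ring_1 set \<Rightarrow> nat \<Rightarrow> 'a set" where
  "symbolic_power J m =
     {f. \<forall>P\<in>associated_primes J. \<exists>s. s \<notin> P \<and> s * f \<in> ideal_power J m}"


section \<open>Polynomials and the Waldschmidt constant\<close>

text \<open>Polynomials over \<open>'a\<close> in variables indexed by the finite type \<open>'n\<close>; for \<open>'n = 3\<close> and
  \<open>'a = complex\<close> this is the ring \<open>\<complex>[x,y,z]\<close>.\<close>

type_synonym ('n, 'a) polynomial = "('n \<Rightarrow>\<^sub>0 nat) \<Rightarrow>\<^sub>0 'a"

definition monomial_degree :: "('n::finite \<Rightarrow>\<^sub>0 nat) \<Rightarrow> nat" where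
  "monomial_degree t = (\<Sum>i\<in>UNIV. Poly_Mapping.lookup t i)"

text \<open>The inserted \<open>0\<close> only affects the zero polynomial.\<close>

definition total_degree :: "('n::finite, 'a::zero) polynomial \<Rightarrow> nat" where
  "total_degree f = Max (insert 0 (monomial_degree ` Poly_Mapping.keys f))"

definition homogeneous :: "('n::finite, 'a::zero) polynomial \<Rightarrow> bool" where
  "homogeneous f \<longleftrightarrow> (\<exists>d. \<forall>t\<in>Poly_Mapping.keys f. monomial_degree t = d)"

definition eval_poly :: "('n::finite, 'a::comm_semiring_1) polynomial \<Rightarrow> 'a ^ 'n \<Rightarrow> 'a" where
  "eval_poly f v = (\<Sum>t\<in>Poly_Mapping.keys f. Poly_Mapping.lookup f t * (\<Prod>i\<in>UNIV. (v $ i) ^ Poly_Mapping.lookup t i))"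

definition initial_degree :: "('n::finite, 'a::zero) polynomial set \<Rightarrow> nat" where
  "initial_degree J = (LEAST d. \<exists>f\<in>J. f \<noteq> 0 \<and> total_degree f = d)"

definition waldschmidt_constant :: "('n::finite, 'a::comm_ring_1) polynomial set \<Rightarrow> real" where
  "waldschmidt_constant J =
     lim (\<lambda>m. real (initial_degree (symbolic_power J m)) / real m)"


section \<open>The projective plane\<close>

text \<open>The point \<open>[v\<^sub>1 : v\<^sub>2 : v\<^sub>3]\<close> of the projective plane, as the set of all its homogeneous
  coordinate vectors (meaningful for \<open>v \<noteq> 0\<close>).\<close>

definition proj_point :: "complex ^ 3 \<Rightarrow> (complex ^ 3) set" where
  "proj_point v = {c *s v | c. c \<noteq> 0}"

definition embed_plane :: "real \<times> real \<Rightarrow> (complex ^ 3) set" where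
  "embed_plane p = proj_point (vector [of_real (fst p), of_real (snd p), 1])"

definition homogeneous_ideal :: "(complex ^ 3) set set \<Rightarrow> (3, complex) polynomial set" where
  "homogeneous_ideal Z =
     ideal_generated {f. homogeneous f \<and> (\<forall>p\<in>Z. \<forall>v\<in>p. eval_poly f v = 0)}"


section \<open>The Boroczky configuration\<close>

definition circle_point :: "real \<Rightarrow> real \<times> real" where
  "circle_point \<theta> = (cos \<theta>, sin \<theta>)"

text \<open>The second case is the tangent line to the unit circle at \<open>P\<close>.\<close>

definition boroczky_line :: "nat \<Rightarrow> nat \<Rightarrow> (real \<times> real) set" where
  "boroczky_line n j =
     (let P = circle_point (2 * pi * real j / real n);
          Q = circle_point (pi - 4 * pi * real j / real n)
      in if P \<noteq> Q then affine hull {P, Q} else {X. (X - P) \<bullet> P = 0})"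

definition boroczky_lines :: "nat \<Rightarrow> (real \<times> real) set set" where
  "boroczky_lines n = boroczky_line n ` {0..n - 1}"

definition triple_points :: "nat \<Rightarrow> (real \<times> real) set" where
  "triple_points n = {p. card {L \<in> boroczky_lines n. p \<in> L} = 3}"

definition boroczky_triple_points :: "nat \<Rightarrow> (complex ^ 3) set set" where
  "boroczky_triple_points n = embed_plane ` triple_points n"

end

theory Submission
  imports Defs "HOL-Computational_Algebra.Polynomial"
begin

text \<open>
  In the isotropic coordinates \<open>u = x + \<i>y\<close>, \<open>v = x - \<i>y\<close> the line \<open>L\<^sub>j\<close> becomes
  \<open>\<zeta>\<^sup>3 - u\<zeta>\<^sup>2 + v\<zeta> - 1 = 0\<close> with \<open>\<zeta> = exp (2\<pi>\<i>j/n)\<close>. Hence a point lies on at most three of the lines, and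
  the triple points correspond to the triples of distinct \<open>n\<close>-th roots of unity with product 1; every line
  contains at least \<open>(n - 4)/2\<close> of them. The product of all lines has degree \<open>n\<close> and vanishes to
  order 3 at the triple points, so the constant is at most \<open>n/3\<close>. Conversely, let \<open>F \<noteq> 0\<close> have degree \<open>d\<close> and
  vanish to order \<open>m\<close> at all triple points, with \<open>3d < mn\<close>. Since \<open>n \<ge> 12\<close>, \<open>d < m(n - 4)/2\<close>, so by Bezout
  every line divides \<open>F\<close>, and dividing by all of them replaces \<open>(d, m)\<close> by \<open>(d - n, m - 3)\<close>; this
  descent ends in a contradiction.
\<close>

hide_const (open) Poly_Mapping.degree

subsection \<open>Ring homomorphisms and substitution\<close>

text \<open>Every evaluation, restriction and change of coordinates below is an instance, so these
  maps compose freely and commute with finite sums, products and powers.\<close>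

locale ring_map =
  fixes \<phi> :: "'a::comm_ring_1 \<Rightarrow> 'b::comm_ring_1"
  assumes map_one: "\<phi> 1 = 1"
    and map_add: "\<phi> (x + y) = \<phi> x + \<phi> y"
    and map_mult: "\<phi> (x * y) = \<phi> x * \<phi> y"
begin

lemma map_zero: "\<phi> 0 = 0"
  using map_add[of 0 0] by simp

lemma map_sum: "\<phi> (sum f A) = (\<Sum>a\<in>A. \<phi> (f a))"
  by (induction A rule: infinite_finite_induct) (simp_all add: map_zero map_add)

lemma map_prod: "\<phi> (prod f A) = (\<Prod>a\<in>A. \<phi> (f a))"
  by (induction A rule: infinite_finite_induct) (simp_all add: map_one map_mult)

lemma map_power: "\<phi> (x ^ k) = \<phi> x ^ k"
  by (induction k) (simp_all add: map_one map_mult)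

end

lemma ring_map_comp: "ring_map f \<Longrightarrow> ring_map g \<Longrightarrow> ring_map (\<lambda>x. g (f x))"
  by (simp add: ring_map_def)

lemma ring_map_const_poly: "ring_map (\<lambda>a. [:a:])"
  by (simp add: ring_map_def pCons_one)

lemma ring_map_poly: "ring_map (\<lambda>p. poly p a)"
  by (simp add: ring_map_def)

lemma ring_map_map_poly:
  assumes "ring_map h" shows "ring_map (map_poly h)"
proof -
  interpret ring_map h by fact
  show ?thesis
  proof
    show "map_poly h 1 = 1" by (simp add: map_poly_1' map_one)
    show "map_poly h (p + q) = map_poly h p + map_poly h q" for p q
      by (rule poly_eqI) (simp add: coeff_map_poly map_zero map_add)
    show "map_poly h (p * q) = map_poly h p * map_poly h q" for p q
      by (rule poly_eqI) (simp add: coeff_map_poly map_zero map_sum map_mult coeff_mult)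
  qed
qed

definition poly_subst :: "('a::comm_ring_1 \<Rightarrow> 'b::comm_ring_1) \<Rightarrow> 'b \<Rightarrow> 'a poly \<Rightarrow> 'b" where
  "poly_subst h x p = poly (map_poly h p) x"

lemma ring_map_poly_subst: "ring_map h \<Longrightarrow> ring_map (poly_subst h x)"
  unfolding poly_subst_def by (rule ring_map_comp[OF ring_map_map_poly ring_map_poly])

lemma poly_subst_pCons:
  assumes "ring_map h"
  shows "poly_subst h x (pCons a p) = h a + x * poly_subst h x p"
  using ring_map.map_zero[OF assms] by (simp add: poly_subst_def map_poly_pCons)

lemma poly_subst_0 [simp]: "poly_subst h x 0 = 0"
  by (simp add: poly_subst_def)

text \<open>Generalizes \<open>eval_poly\<close>: the separate coefficient map \<open>h\<close>
  allows values in polynomial rings, as needed for scaling along a vector, for the Kronecker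
  substitution and for the isotropic chart.\<close>

definition subst :: "('a::comm_ring_1 \<Rightarrow> 'b::comm_ring_1) \<Rightarrow> ('n::finite \<Rightarrow> 'b)
    \<Rightarrow> ('n, 'a) polynomial \<Rightarrow> 'b" where
  "subst h x f = (\<Sum>t\<in>Poly_Mapping.keys f. h (Poly_Mapping.lookup f t) *
     (\<Prod>i\<in>UNIV. x i ^ Poly_Mapping.lookup t i))"

lemma eval_poly_eq_subst: "eval_poly f v = subst (\<lambda>a. a) (($) v) f"
  by (simp add: eval_poly_def subst_def)

lemma poly_mapping_sum_single:
  "(\<Sum>t\<in>Poly_Mapping.keys f. Poly_Mapping.single t (Poly_Mapping.lookup f t)) = f"
proof (rule poly_mapping_eqI)
  fix k
  have "(\<Sum>t\<in>Poly_Mapping.keys f. Poly_Mapping.lookup (Poly_Mapping.single t (Poly_Mapping.lookup f t)) k)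
      = (\<Sum>t\<in>Poly_Mapping.keys f. if t = k then Poly_Mapping.lookup f k else 0)"
    by (rule sum.cong) (auto simp: lookup_single)
  then show "Poly_Mapping.lookup (\<Sum>t\<in>Poly_Mapping.keys f.
      Poly_Mapping.single t (Poly_Mapping.lookup f t)) k = Poly_Mapping.lookup f k"
    by (auto simp: lookup_sum in_keys_iff)
qed

context
  fixes h :: "'a::comm_ring_1 \<Rightarrow> 'b::comm_ring_1"
  assumes h: "ring_map h"
begin

interpretation ring_map h by (rule h)

lemma subst_superset:
  assumes "finite S" "Poly_Mapping.keys f \<subseteq> S"
  shows "subst h x f = (\<Sum>t\<in>S. h (Poly_Mapping.lookup f t) *
    (\<Prod>i\<in>UNIV. x i ^ Poly_Mapping.lookup t i))"
  unfolding subst_def using assms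
  by (intro sum.mono_neutral_left) (auto simp: in_keys_iff map_zero)

lemma subst_add: "subst h x (f + g) = subst h x f + subst h x g"
proof -
  let ?S = "Poly_Mapping.keys f \<union> Poly_Mapping.keys g"
  have "subst h x p = (\<Sum>t\<in>?S. h (Poly_Mapping.lookup p t) *
    (\<Prod>i\<in>UNIV. x i ^ Poly_Mapping.lookup t i))" if "p \<in> {f, g, f + g}" for p
    using that keys_add[of f g] by (intro subst_superset) auto
  then show ?thesis
    by (simp add: lookup_add map_add distrib_right sum.distrib)
qed

lemma subst_zero: "subst h x 0 = 0"
  by (simp add: subst_def)

lemma subst_sum: "subst h x (sum g A) = (\<Sum>a\<in>A. subst h x (g a))"
  by (induction A rule: infinite_finite_induct) (simp_all add: subst_zero subst_add)

lemma subst_single: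
  "subst h x (Poly_Mapping.single t a) = h a * (\<Prod>i\<in>UNIV. x i ^ Poly_Mapping.lookup t i)"
  by (subst subst_superset[of "{t}"]) (auto)

text \<open>Multiplicativity is checked on single terms, where exponents add, and extends by
  distributivity because every polynomial is the sum of its terms.\<close>

lemma ring_map_subst: "ring_map (subst h (x :: 'n::finite \<Rightarrow> 'b))"
proof
  show "subst h x 1 = 1"
    unfolding single_one[symmetric] by (subst subst_single) (simp add: map_one)
  show "subst h x (f + g) = subst h x f + subst h x g" for f g
    by (rule subst_add)
  fix f g :: "('n, 'a) polynomial"
  let ?s = "\<lambda>f t. Poly_Mapping.single t (Poly_Mapping.lookup f t)"
  have single: "subst h x (Poly_Mapping.single t a * Poly_Mapping.single u b)
      = subst h x (Poly_Mapping.single t a) * subst h x (Poly_Mapping.single u b)" for t u a b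
    by (simp add: mult_single subst_single map_mult lookup_add power_add prod.distrib)
  have "subst h x (f * g) = subst h x ((\<Sum>t\<in>Poly_Mapping.keys f. ?s f t) * (\<Sum>t\<in>Poly_Mapping.keys g. ?s g t))"
    by (simp only: poly_mapping_sum_single)
  also have "\<dots> = (\<Sum>t\<in>Poly_Mapping.keys f. subst h x (?s f t)) * (\<Sum>t\<in>Poly_Mapping.keys g. subst h x (?s g t))"
    by (simp only: sum_product subst_sum single)
  also have "\<dots> = subst h x f * subst h x g"
    by (simp only: subst_sum[symmetric] poly_mapping_sum_single)
  finally show "subst h x (f * g) = subst h x f * subst h x g" .
qed

end

lemma subst_comp:
  assumes "ring_map \<phi>"
  shows "\<phi> (subst h x f) = subst (\<lambda>a. \<phi> (h a)) (\<lambda>i. \<phi> (x i)) f"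
proof -
  interpret ring_map \<phi> by fact
  show ?thesis by (simp add: subst_def map_sum map_mult map_prod map_power)
qed

definition linear_form :: "'a::comm_ring_1 ^ 'n::finite \<Rightarrow> ('n, 'a) polynomial" where
  "linear_form a = (\<Sum>i\<in>UNIV. Poly_Mapping.single (Poly_Mapping.single i 1) (a $ i))"

lemma subst_linear_form:
  assumes "ring_map h"
  shows "subst h x (linear_form a) = (\<Sum>i\<in>UNIV. h (a $ i) * x i)"
proof -
  have "(\<Prod>j\<in>UNIV. x j ^ Poly_Mapping.lookup (Poly_Mapping.single i 1) j) = x i" for i
  proof -
    have "(\<Prod>j\<in>UNIV. x j ^ Poly_Mapping.lookup (Poly_Mapping.single i 1) j)
        = (\<Prod>j\<in>UNIV. if j = i then x i else 1)"
      by (rule prod.cong) (auto simp: lookup_single)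
    then show ?thesis by simp
  qed
  then show ?thesis
    by (simp add: linear_form_def subst_sum[OF assms] subst_single[OF assms])
qed

subsection \<open>Degrees\<close>

lemma monomial_degree_add: "monomial_degree (s + t) = monomial_degree s + monomial_degree t"
  by (simp add: monomial_degree_def lookup_add sum.distrib)

lemma monomial_degree_le_total_degree:
  "t \<in> Poly_Mapping.keys f \<Longrightarrow> monomial_degree t \<le> total_degree f"
  unfolding total_degree_def by (rule Max_ge) auto

lemma total_degree_le_iff:
  "total_degree f \<le> d \<longleftrightarrow> (\<forall>t\<in>Poly_Mapping.keys f. monomial_degree t \<le> d)"
  by (simp add: total_degree_def)

lemma total_degree_mult_le: "total_degree (f * g) \<le> total_degree f + total_degree g"
  unfolding total_degree_le_iff
proof
  fix t assume "t \<in> Poly_Mapping.keys (f * g)"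
  then obtain a b where "a \<in> Poly_Mapping.keys f" "b \<in> Poly_Mapping.keys g" "t = a + b"
    using keys_mult[of f g] by blast
  then show "monomial_degree t \<le> total_degree f + total_degree g"
    by (simp add: monomial_degree_add add_mono monomial_degree_le_total_degree)
qed

lemma total_degree_one [simp]: "total_degree (1 :: ('n::finite, 'a::comm_ring_1) polynomial) = 0"
  by (simp add: total_degree_def monomial_degree_def)

lemma total_degree_prod_le:
  fixes f :: "'b \<Rightarrow> ('n::finite, 'a::comm_ring_1) polynomial"
  shows "total_degree (prod f A) \<le> (\<Sum>a\<in>A. total_degree (f a))"
proof (induction A rule: infinite_finite_induct)
  case (insert a A)
  then show ?case using total_degree_mult_le[of "f a" "prod f A"] by simp
qed simp_all

lemma total_degree_linear_form: "total_degree (linear_form a) \<le> 1"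
  unfolding total_degree_le_iff
proof
  fix t assume "t \<in> Poly_Mapping.keys (linear_form a)"
  from subsetD[OF keys_sum this[unfolded linear_form_def]]
  obtain i where "t \<in> Poly_Mapping.keys (Poly_Mapping.single (Poly_Mapping.single i 1) (a $ i))"
    by (elim UN_E)
  then have "t = Poly_Mapping.single i 1" by (auto split: if_splits)
  moreover have "monomial_degree (Poly_Mapping.single i (1::nat)) = (\<Sum>j\<in>UNIV. if j = i then 1 else 0)"
    unfolding monomial_degree_def by (rule sum.cong) (auto simp: lookup_single)
  ultimately show "monomial_degree t \<le> 1" by simp
qed

text \<open>Coefficients become constants and variables become at most linear, so no monomial can
  gain degree.\<close>

lemma degree_subst_le:
  fixes x :: "'n::finite \<Rightarrow> 'b::comm_ring_1 poly"
  assumes "\<And>a. degree (h a) = 0" and "\<And>i. degree (x i) \<le> 1"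
  shows "degree (subst h x f) \<le> total_degree f"
  unfolding subst_def
proof (rule degree_sum_le)
  fix t assume t: "t \<in> Poly_Mapping.keys f"
  have "degree (\<Prod>i\<in>UNIV. x i ^ Poly_Mapping.lookup t i)
      \<le> (\<Sum>i\<in>UNIV. degree (x i ^ Poly_Mapping.lookup t i))"
    using degree_prod_sum_le[of UNIV "\<lambda>i. x i ^ Poly_Mapping.lookup t i"] by (simp add: o_def)
  also have "\<dots> \<le> monomial_degree t"
    unfolding monomial_degree_def
  proof (rule sum_mono)
    fix i
    have "degree (x i ^ Poly_Mapping.lookup t i) \<le> degree (x i) * Poly_Mapping.lookup t i"
      by (rule degree_power_le)
    also have "\<dots> \<le> 1 * Poly_Mapping.lookup t i"
      using assms(2) by (rule mult_right_mono) simp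
    finally show "degree (x i ^ Poly_Mapping.lookup t i) \<le> Poly_Mapping.lookup t i" by simp
  qed
  also have "\<dots> \<le> total_degree f" by (rule monomial_degree_le_total_degree[OF t])
  finally have "degree (\<Prod>i\<in>UNIV. x i ^ Poly_Mapping.lookup t i) \<le> total_degree f" .
  then have "degree (h (Poly_Mapping.lookup f t)) + degree (\<Prod>i\<in>UNIV. x i ^ Poly_Mapping.lookup t i)
      \<le> total_degree f"
    by (simp only: assms(1) add_0)
  then show "degree (h (Poly_Mapping.lookup f t) * (\<Prod>i\<in>UNIV. x i ^ Poly_Mapping.lookup t i))
      \<le> total_degree f"
    by (rule le_trans[OF degree_mult_le])
qed simp

subsection \<open>Kernels of evaluation maps and symbolic powers\<close>

lemma ideal_power_mult_closed:
  "a \<in> J \<Longrightarrow> b \<in> ideal_power J m \<Longrightarrow> a * b \<in> ideal_power J (Suc m)"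
  by (auto intro: ring_module.span_base)

lemma is_ideal_power: "is_ideal (ideal_power J m)"
  by (cases m) (simp_all add: ring_module.subspace_UNIV)

lemma ideal_absorbs: "is_ideal I \<Longrightarrow> a \<in> I \<Longrightarrow> r * a \<in> I"
  by (rule ring_module.subspace_scale)

lemma ideal_power_Suc_subset: "ideal_power J (Suc m) \<subseteq> ideal_power J m"
  unfolding ideal_power.simps
  by (rule ring_module.span_minimal) (auto intro: ideal_absorbs is_ideal_power)

lemma ideal_power_antimono: "m \<le> k \<Longrightarrow> ideal_power J k \<subseteq> ideal_power J m"
  using lift_Suc_antimono_le[of "ideal_power J" m k] ideal_power_Suc_subset by blast

text \<open>Applied to the three lines through a triple point, each multiplied by a form that
  vanishes at the other triple points.\<close>

lemma power_mem_ideal_power: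
  assumes "a \<in> J" "b \<in> J" "c \<in> J"
  shows "(a * b * c) ^ k \<in> ideal_power J (3 * k)"
proof (induction k)
  case (Suc k)
  have "a * (b * (c * (a * b * c) ^ k)) \<in> ideal_power J (Suc (Suc (Suc (3 * k))))"
    by (intro ideal_power_mult_closed assms Suc)
  moreover have "Suc (Suc (Suc (3 * k))) = 3 * Suc k" by simp
  ultimately show ?case by (simp only: power_Suc mult.assoc)
qed simp

text \<open>Converts membership in an ideal power into order of vanishing: with \<open>p\<close> the
  local parameter of a blown-up point, \<open>J ^ m\<close> maps to elements of order at least
  \<open>m\<close>.\<close>

lemma ideal_power_dvd:
  fixes \<phi> :: "'a::comm_ring_1 \<Rightarrow> 'b::comm_ring_1"
  assumes "ring_map \<phi>" "\<And>a. a \<in> J \<Longrightarrow> p dvd \<phi> a"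
  shows "f \<in> ideal_power J m \<Longrightarrow> p ^ m dvd \<phi> f"
proof (induction m arbitrary: f)
  case (Suc m)
  interpret ring_map \<phi> by fact
  have "{a * b |a b. a \<in> J \<and> b \<in> ideal_power J m} \<subseteq> {f. p ^ Suc m dvd \<phi> f}"
    using assms(2) Suc.IH by (auto simp: map_mult intro!: mult_dvd_mono)
  moreover have "is_ideal {f. p ^ Suc m dvd \<phi> f}"
    by (auto simp: ring_module.subspace_def map_zero map_add map_mult simp del: power_Suc)
  ultimately have "ideal_power J (Suc m) \<subseteq> {f. p ^ Suc m dvd \<phi> f}"
    unfolding ideal_power.simps by (rule ring_module.span_minimal)
  then show ?case using Suc.prems by blast
qed simp

lemma prime_ideal_prod_mem:
  assumes "prime_ideal P" "finite A" "prod f A \<in> P"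
  shows "\<exists>a\<in>A. f a \<in> P"
  using assms(2,3)
proof (induction A rule: finite_induct)
  case empty
  then have "is_ideal P" "1 \<in> P" using assms(1) by (auto simp: prime_ideal_def)
  then have "r \<in> P" for r using ideal_absorbs[of P 1 r] by simp
  then show ?case using assms(1) by (auto simp: prime_ideal_def)
next
  case (insert x F)
  then have "f x \<in> P \<or> prod f F \<in> P" using assms(1) by (auto simp: prime_ideal_def)
  then show ?case using insert by auto
qed

section \<open>Symbolic powers of a finite intersection of kernels\<close>

context
  fixes \<psi> :: "'i \<Rightarrow> 'a::comm_ring_1 \<Rightarrow> 'b::idom" and V :: "'i set" and J :: "'a set"
    and h :: "'i \<Rightarrow> 'a"
  assumes ring_map: "\<And>q. q \<in> V \<Longrightarrow> ring_map (\<psi> q)"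
    and fin: "finite V"
    and J: "J = {f. \<forall>q\<in>V. \<psi> q f = 0}"
    and sep_nz: "\<And>q. q \<in> V \<Longrightarrow> \<psi> q (h q) \<noteq> 0"
    and sep_z: "\<And>q p. q \<in> V \<Longrightarrow> p \<in> V \<Longrightarrow> p \<noteq> q \<Longrightarrow> \<psi> p (h q) = 0"
begin

lemma prime_ideal_kernel:
  assumes "q \<in> V" shows "prime_ideal {f. \<psi> q f = 0}"
proof -
  interpret ring_map "\<psi> q" by (rule ring_map[OF assms])
  have "1 \<notin> {f. \<psi> q f = 0}" by (simp add: map_one)
  then have "{f. \<psi> q f = 0} \<noteq> UNIV" by blast
  then show ?thesis
    by (auto simp: prime_ideal_def ring_module.subspace_def map_zero map_add map_mult)
qed

text \<open>A colon ideal \<open>J : g\<close> is the intersection of the kernels of those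
  \<open>q\<close> with \<open>\<psi> q g \<noteq> 0\<close>. If it differed from each of them,
  every such kernel would contain an element outside it, and the product of these elements would
  contradict primeness. Conversely, the separating element \<open>h q\<close> realizes the kernel of
  \<open>\<psi> q\<close> as \<open>J : h q\<close>.\<close>

lemma associated_primes_intersection: "associated_primes J = (\<lambda>q. {f. \<psi> q f = 0}) ` V"
proof (intro equalityI subsetI)
  fix P assume "P \<in> associated_primes J"
  then obtain g where P: "prime_ideal P" and g: "P = {r. r * g \<in> J}"
    by (auto simp: associated_primes_def)
  have P_iff: "r \<in> P \<longleftrightarrow> (\<forall>q\<in>V. \<psi> q g \<noteq> 0 \<longrightarrow> \<psi> q r = 0)" for r
    using ring_map by (auto simp: g J ring_map.map_mult)
  define A where "A = {q\<in>V. \<psi> q g \<noteq> 0}"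
  have "finite A" using fin by (simp add: A_def)
  show "P \<in> (\<lambda>q. {f. \<psi> q f = 0}) ` V"
  proof (rule ccontr)
    assume "\<not> ?thesis"
    then have "\<forall>q\<in>A. \<exists>r. \<psi> q r = 0 \<and> r \<notin> P" using P_iff by (force simp: A_def)
    then obtain r where r: "\<And>q. q \<in> A \<Longrightarrow> \<psi> q (r q) = 0" "\<And>q. q \<in> A \<Longrightarrow> r q \<notin> P"
      by metis
    have "\<psi> q (prod r A) = 0" if "q \<in> A" for q
    proof -
      interpret ring_map "\<psi> q" by (rule ring_map) (use that in \<open>simp add: A_def\<close>)
      show ?thesis using that r(1) \<open>finite A\<close> by (auto simp: map_prod)
    qed
    then have "prod r A \<in> P" by (simp add: P_iff A_def)
    then show False using prime_ideal_prod_mem[OF P \<open>finite A\<close>] r(2) by blast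
  qed
next
  fix P assume "P \<in> (\<lambda>q. {f. \<psi> q f = 0}) ` V"
  then obtain q where q: "q \<in> V" "P = {f. \<psi> q f = 0}" by blast
  have "r \<in> P \<longleftrightarrow> r * h q \<in> J" for r
    using q sep_nz[of q] sep_z[of q] by (auto simp: J ring_map.map_mult[OF ring_map])
  then show "P \<in> associated_primes J"
    using prime_ideal_kernel[OF q(1)] q by (auto simp: associated_primes_def intro!: exI[of _ "h q"])
qed

lemma mem_symbolic_power_iff:
  "f \<in> symbolic_power J m \<longleftrightarrow> (\<forall>q\<in>V. \<exists>s. \<psi> q s \<noteq> 0 \<and> s * f \<in> ideal_power J m)"
  by (auto simp: symbolic_power_def associated_primes_intersection)

end

subsection \<open>The ideal of a set of points\<close>

text \<open>The restriction of a polynomial to the multiples of \<open>v\<close>, as a polynomial in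
  the scale. For \<open>v \<noteq> 0\<close> the kernel is the homogeneous prime of the projective
  point; evaluation at the single vector \<open>v\<close> would give an inhomogeneous maximal ideal
  instead.\<close>

definition cone_poly :: "complex ^ 3 \<Rightarrow> (3, complex) polynomial \<Rightarrow> complex poly" where
  "cone_poly v = subst (\<lambda>a. [:a:]) (\<lambda>i. [:0, v $ i:])"

lemma ring_map_cone_poly: "ring_map (cone_poly v)"
  unfolding cone_poly_def by (rule ring_map_subst[OF ring_map_const_poly])

lemma poly_cone_poly: "poly (cone_poly v f) c = eval_poly f (c *s v)"
  unfolding cone_poly_def eval_poly_eq_subst
  by (subst subst_comp[OF ring_map_poly]) (simp add: subst_def)

lemma cone_poly_single:
  "cone_poly v (Poly_Mapping.single t a) =
     monom (a * (\<Prod>i\<in>UNIV. v $ i ^ Poly_Mapping.lookup t i)) (monomial_degree t)"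
proof -
  have "(\<Prod>i\<in>A. [:0, v $ i:] ^ Poly_Mapping.lookup t i) =
      monom (\<Prod>i\<in>A. v $ i ^ Poly_Mapping.lookup t i) (\<Sum>i\<in>A. Poly_Mapping.lookup t i)" for A
  proof (induction A rule: infinite_finite_induct)
    case (insert i A)
    have "[:0, v $ i:] = monom (v $ i) 1" by (simp add: monom_Suc monom_0)
    then show ?case using insert by (simp add: monom_power mult_monom)
  qed (simp_all add: monom_0 pCons_one)
  then show ?thesis
    unfolding cone_poly_def by (subst subst_single[OF ring_map_const_poly])
      (simp add: monomial_degree_def smult_monom)
qed

definition homogeneous_part :: "nat \<Rightarrow> ('n::finite, 'a::comm_ring_1) polynomial \<Rightarrow> ('n, 'a) polynomial" where
  "homogeneous_part d f = (\<Sum>t | t \<in> Poly_Mapping.keys f \<and> monomial_degree t = d.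
     Poly_Mapping.single t (Poly_Mapping.lookup f t))"

lemma homogeneous_homogeneous_part: "homogeneous (homogeneous_part d f)"
  unfolding homogeneous_def
proof (intro exI ballI)
  fix t assume "t \<in> Poly_Mapping.keys (homogeneous_part d f)"
  from subsetD[OF keys_sum this[unfolded homogeneous_part_def]]
  show "monomial_degree t = d" by (auto split: if_splits)
qed

lemma sum_homogeneous_part:
  "(\<Sum>d\<in>monomial_degree ` Poly_Mapping.keys f. homogeneous_part d f) = f"
proof -
  have "(\<Sum>d\<in>monomial_degree ` Poly_Mapping.keys f. homogeneous_part d f)
      = (\<Sum>t\<in>Poly_Mapping.keys f. Poly_Mapping.single t (Poly_Mapping.lookup f t))"
    unfolding homogeneous_part_def by (rule sum.image_gen[symmetric]) simp
  then show ?thesis by (simp add: poly_mapping_sum_single)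
qed

text \<open>A monomial of degree \<open>d\<close> scales by the \<open>d\<close>-th power, so each
  coefficient of \<open>cone_poly v f\<close> sees exactly one homogeneous component. This makes the
  kernel a homogeneous ideal.\<close>

lemma cone_poly_homogeneous_part:
  "cone_poly v (homogeneous_part d f) = monom (coeff (cone_poly v f) d) d"
proof -
  interpret ring_map "cone_poly v" by (rule ring_map_cone_poly)
  let ?c = "\<lambda>t. Poly_Mapping.lookup f t * (\<Prod>i\<in>UNIV. v $ i ^ Poly_Mapping.lookup t i)"
  have f: "cone_poly v f = (\<Sum>t\<in>Poly_Mapping.keys f. monom (?c t) (monomial_degree t))"
    by (subst poly_mapping_sum_single[symmetric]) (simp only: map_sum cone_poly_single)
  have d: "cone_poly v (homogeneous_part d f) =
      (\<Sum>t | t \<in> Poly_Mapping.keys f \<and> monomial_degree t = d. monom (?c t) (monomial_degree t))"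
    unfolding homogeneous_part_def by (simp only: map_sum cone_poly_single)
  show ?thesis
  proof (rule poly_eqI)
    fix k
    have "coeff (cone_poly v (homogeneous_part d f)) k =
        (\<Sum>t | t \<in> Poly_Mapping.keys f \<and> monomial_degree t = d. if d = k then ?c t else 0)"
      unfolding d coeff_sum by (rule sum.cong) auto
    moreover have "coeff (cone_poly v f) d =
        (\<Sum>t | t \<in> Poly_Mapping.keys f \<and> monomial_degree t = d. ?c t)"
      unfolding f coeff_sum by (subst sum.inter_filter) (auto intro: sum.cong)
    ultimately show "coeff (cone_poly v (homogeneous_part d f)) k = coeff (monom (coeff (cone_poly v f) d) d) k"
      by simp
  qed
qed

text \<open>A nonzero polynomial cannot have all of the infinitely many nonzero scalars as
  roots.\<close>

lemma cone_poly_eq_0_iff: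
  "cone_poly v f = 0 \<longleftrightarrow> (\<forall>c. c \<noteq> 0 \<longrightarrow> eval_poly f (c *s v) = 0)"
proof
  assume *: "\<forall>c. c \<noteq> 0 \<longrightarrow> eval_poly f (c *s v) = 0"
  show "cone_poly v f = 0"
  proof (rule ccontr)
    assume "cone_poly v f \<noteq> 0"
    then have "finite {c. poly (cone_poly v f) c = 0}" by (rule poly_roots_finite)
    moreover have "UNIV - {0} \<subseteq> {c. poly (cone_poly v f) c = 0}"
      using * by (auto simp: poly_cone_poly)
    ultimately have "finite (UNIV - {0 :: complex})" by (rule finite_subset[rotated])
    then show False by (simp add: infinite_UNIV_char_0)
  qed
qed (simp add: poly_cone_poly[symmetric])

text \<open>The nontrivial inclusion splits \<open>f\<close> into homogeneous components; each has
  vanishing \<open>cone_poly\<close> at every point and is therefore a generator.\<close>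

lemma homogeneous_ideal_proj_points:
  "homogeneous_ideal (proj_point ` V) = {f. \<forall>v\<in>V. cone_poly v f = 0}" (is "_ = ?J")
proof
  have gen: "{f. homogeneous f \<and> (\<forall>p\<in>proj_point ` V. \<forall>v\<in>p. eval_poly f v = 0)}
      = {f \<in> ?J. homogeneous f}"
    by (auto simp: cone_poly_eq_0_iff proj_point_def)
  have ideal: "is_ideal ?J"
    using ring_map_cone_poly
    by (auto simp: ring_module.subspace_def ring_map.map_zero ring_map.map_add ring_map.map_mult)
  show "homogeneous_ideal (proj_point ` V) \<subseteq> ?J"
    unfolding homogeneous_ideal_def gen by (rule ring_module.span_minimal[OF _ ideal]) auto
  show "?J \<subseteq> homogeneous_ideal (proj_point ` V)"
  proof
    fix f assume f: "f \<in> ?J"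
    have "homogeneous_part d f \<in> homogeneous_ideal (proj_point ` V)" for d
      unfolding homogeneous_ideal_def gen using f
      by (intro ring_module.span_base)
        (simp add: homogeneous_homogeneous_part cone_poly_homogeneous_part)
    then have "(\<Sum>d\<in>monomial_degree ` Poly_Mapping.keys f. homogeneous_part d f)
        \<in> homogeneous_ideal (proj_point ` V)"
      unfolding homogeneous_ideal_def by (intro ring_module.span_sum)
    then show "f \<in> homogeneous_ideal (proj_point ` V)" by (simp add: sum_homogeneous_part)
  qed
qed

subsection \<open>The lines in isotropic coordinates\<close>

definition unity_roots :: "nat \<Rightarrow> complex set" where
  "unity_roots n = {z. z ^ n = 1}"

definition complex_of_point :: "real \<times> real \<Rightarrow> complex" where
  "complex_of_point p = Complex (fst p) (snd p)"

lemma complex_of_point_Re_Im: "complex_of_point (Re u, Im u) = u"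
  by (simp add: complex_of_point_def)

lemma inj_complex_of_point: "inj complex_of_point"
  by (auto simp: inj_def complex_of_point_def prod_eq_iff)

text \<open>Multiplying the equation of the chord through \<open>\<zeta>\<close> and \<open>- \<zeta>\<^sup>-\<^sup>2\<close> by \<open>- \<zeta>\<^sup>2\<close> gives a cubic in \<open>\<zeta>\<close>; its
  roots are the lines through \<open>u\<close>.\<close>

definition incident :: "complex \<Rightarrow> complex \<Rightarrow> bool" where
  "incident \<zeta> u \<longleftrightarrow> \<zeta> ^ 3 - u * \<zeta> ^ 2 + cnj u * \<zeta> - 1 = 0"

lemma unity_roots_cnj: "0 < n \<Longrightarrow> \<zeta> \<in> unity_roots n \<Longrightarrow> \<zeta> * cnj \<zeta> = 1"
  using power_eq_1_iff[of \<zeta> n] by (simp add: unity_roots_def complex_norm_square[symmetric])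

lemma unity_roots_nonzero: "0 < n \<Longrightarrow> \<zeta> \<in> unity_roots n \<Longrightarrow> \<zeta> \<noteq> 0"
  by (auto simp: unity_roots_def zero_power)

lemma finite_unity_roots: "0 < n \<Longrightarrow> finite (unity_roots n)"
  unfolding unity_roots_def by (rule finite_roots_unity) simp

lemma card_unity_roots: "0 < n \<Longrightarrow> card (unity_roots n) = n"
  unfolding unity_roots_def by (rule card_roots_unity_eq)

text \<open>The point \<open>z\<close> is on the chord iff \<open>(z - a) / (b - a)\<close> equals
  its conjugate. On the unit circle conjugation is inversion, which turns this into an equation
  linear in \<open>z\<close> and \<open>cnj z\<close>.\<close>

lemma chord_iff:
  assumes a: "a * cnj a = 1" and b: "b * cnj b = 1" and "a \<noteq> b"
  shows "(\<exists>t::real. z = a + of_real t * (b - a)) \<longleftrightarrow> z + a * b * cnj z = a + b"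
proof
  assume "\<exists>t::real. z = a + of_real t * (b - a)"
  then obtain t :: real where z: "z = a + of_real t * (b - a)" ..
  then have "cnj z = cnj a + of_real t * (cnj b - cnj a)" by simp
  with z a b show "z + a * b * cnj z = a + b" by algebra
next
  assume eq: "z + a * b * cnj z = a + b"
  define t where "t = (z - a) / (b - a)"
  have ne: "b - a \<noteq> 0" "cnj b - cnj a \<noteq> 0" using \<open>a \<noteq> b\<close> by simp_all
  have "(cnj z - cnj a) * (b - a) = (z - a) * (cnj b - cnj a)"
    using eq a b by algebra
  then have "cnj t = t" unfolding t_def complex_cnj_divide complex_cnj_diff
    by (rule iffD2[OF frac_eq_eq[OF ne(2,1)]])
  then have "t \<in> \<real>" by (simp add: Reals_cnj_iff)
  then obtain s :: real where "t = of_real s" by (rule Reals_cases)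
  moreover have "z = a + t * (b - a)" using ne by (simp add: t_def)
  ultimately show "\<exists>t::real. z = a + of_real t * (b - a)" by blast
qed

text \<open>The inner product is the real part of \<open>(z - a) * cnj a\<close>. The result is the
  chord equation with \<open>b = a\<close>, so chords and tangents need no distinction
  afterwards.\<close>

lemma tangent_iff:
  assumes a: "a * cnj a = 1"
  shows "Re (z - a) * Re a + Im (z - a) * Im a = 0 \<longleftrightarrow> z + a * a * cnj z = a + a"
proof -
  have "(z - a) * cnj a + cnj ((z - a) * cnj a)
      = of_real (2 * (Re (z - a) * Re a + Im (z - a) * Im a))"
    unfolding complex_add_cnj by simp
  also have "cnj ((z - a) * cnj a) = (cnj z - cnj a) * a" by simp
  finally have "Re (z - a) * Re a + Im (z - a) * Im a = 0
      \<longleftrightarrow> (z - a) * cnj a + (cnj z - cnj a) * a = 0"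
    by (simp only: of_real_eq_0_iff mult_eq_0_iff) simp
  also have "\<dots> \<longleftrightarrow> z + a * a * cnj z = a + a"
  proof
    show "z + a * a * cnj z = a + a" if "(z - a) * cnj a + (cnj z - cnj a) * a = 0"
      using that a by algebra
    show "(z - a) * cnj a + (cnj z - cnj a) * a = 0" if "z + a * a * cnj z = a + a"
      using that a by algebra
  qed
  finally show ?thesis .
qed

lemma mem_boroczky_line_iff:
  assumes "0 < n"
  shows "p \<in> boroczky_line n j \<longleftrightarrow> incident (cis (2 * pi * real j / real n)) (complex_of_point p)"
proof -
  define \<theta> where "\<theta> = 2 * pi * real j / real n"
  define a where "a = cis \<theta>"
  define b where "b = cis (pi - 2 * \<theta>)"
  define z where "z = complex_of_point p"
  have a1: "a * cnj a = 1" and b1: "b * cnj b = 1"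
    by (simp_all add: a_def b_def cis_cnj cis_mult)
  \<comment> \<open>The second endpoint is \<open>b = - inverse (a ^ 2)\<close>; this relation
    eliminates \<open>b\<close> from the line equation and leaves the cubic in
    \<open>a\<close>.\<close>
  have "a * (a * b) = cis pi" by (simp add: a_def b_def cis_mult)
  then have aab: "a * (a * b) = - 1" by simp
  have nz: "a \<noteq> 0" using a1 by auto
  have line: "boroczky_line n j = (if a \<noteq> b then affine hull {circle_point \<theta>, circle_point (pi - 2 * \<theta>)}
      else {X. (X - circle_point \<theta>) \<bullet> circle_point \<theta> = 0})"
    by (simp add: boroczky_line_def Let_def \<theta>_def circle_point_def a_def b_def complex_eq_iff)
  have "p \<in> boroczky_line n j \<longleftrightarrow> z + a * b * cnj z = a + b"
  proof (cases "a = b")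
    case True
    then have "p \<in> boroczky_line n j \<longleftrightarrow> (p - circle_point \<theta>) \<bullet> circle_point \<theta> = 0"
      by (simp add: line)
    also have "\<dots> \<longleftrightarrow> Re (z - a) * Re a + Im (z - a) * Im a = 0"
      by (simp add: circle_point_def a_def z_def complex_of_point_def inner_prod_def)
    also have "\<dots> \<longleftrightarrow> z + a * a * cnj z = a + a" by (rule tangent_iff[OF a1])
    finally show ?thesis using True by simp
  next
    case False
    have "p \<in> boroczky_line n j \<longleftrightarrow> (\<exists>t. p = circle_point \<theta> + t *\<^sub>R (circle_point (pi - 2 * \<theta>) - circle_point \<theta>))"
      using False by (auto simp: line affine_hull_2_alt)
    also have "\<dots> \<longleftrightarrow> (\<exists>t. z = a + of_real t * (b - a))"
      by (simp add: circle_point_def a_def b_def z_def complex_of_point_def complex_eq_iff prod_eq_iff)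
    also have "\<dots> \<longleftrightarrow> z + a * b * cnj z = a + b"
      by (rule chord_iff[OF a1 b1 False])
    finally show ?thesis .
  qed
  also have "\<dots> \<longleftrightarrow> incident a z"
    unfolding incident_def
  proof
    show "a ^ 3 - z * a ^ 2 + cnj z * a - 1 = 0" if "z + a * b * cnj z = a + b"
      using that aab by algebra
    assume "a ^ 3 - z * a ^ 2 + cnj z * a - 1 = 0"
    then have "(a * a) * (z + a * b * cnj z - (a + b)) = 0" using aab by algebra
    then show "z + a * b * cnj z = a + b" using nz by simp
  qed
  finally show ?thesis by (simp only: a_def z_def \<theta>_def)
qed

definition incident_points :: "complex \<Rightarrow> (real \<times> real) set" where
  "incident_points \<zeta> = {p. incident \<zeta> (complex_of_point p)}"

lemma boroczky_lines_eq:
  assumes "0 < n" shows "boroczky_lines n = incident_points ` unity_roots n"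
proof -
  have "boroczky_line n j = incident_points (cis (2 * pi * real j / real n))" for j
    using mem_boroczky_line_iff[OF assms] by (auto simp: incident_points_def)
  then have "boroczky_lines n = incident_points ` (\<lambda>k. cis (2 * pi * real k / real n)) ` {0..n - 1}"
    by (simp add: boroczky_lines_def image_image)
  also have "{0..n - 1} = {..<n}" using assms by auto
  also have "(\<lambda>k. cis (2 * pi * real k / real n)) ` {..<n} = unity_roots n"
    using Complex.bij_betw_roots_unity[OF assms] by (simp add: bij_betw_def unity_roots_def)
  finally show ?thesis .
qed

text \<open>The cubic in \<open>incident\<close> has root product 1 and root sum \<open>u\<close>,
  so two of its roots determine the third and the point.\<close>

definition meet_point :: "complex \<Rightarrow> complex \<Rightarrow> complex" where
  "meet_point \<zeta> \<beta> = \<zeta> + \<beta> + inverse (\<zeta> * \<beta>)"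

section \<open>Intersection points of the lines\<close>

context
  fixes n :: nat
  assumes n: "0 < n"
begin

text \<open>Since conjugation inverts roots of unity, the coefficients of the cubic at this point
  are the elementary symmetric functions of \<open>\<zeta>\<close>, \<open>\<beta>\<close> and
  \<open>inverse (\<zeta> * \<beta>)\<close>, and the cubic splits accordingly.\<close>

lemma incident_meet_point:
  assumes "\<zeta> \<in> unity_roots n" "\<beta> \<in> unity_roots n"
  shows "incident \<eta> (meet_point \<zeta> \<beta>) \<longleftrightarrow> \<eta> = \<zeta> \<or> \<eta> = \<beta> \<or> \<eta> = inverse (\<zeta> * \<beta>)"
proof -
  have nz: "\<zeta> \<noteq> 0" "\<beta> \<noteq> 0" using unity_roots_nonzero[OF n] assms by auto
  have cnj: "cnj \<zeta> = inverse \<zeta>" "cnj \<beta> = inverse \<beta>"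
    using unity_roots_cnj[OF n] assms nz by (auto simp: inverse_eq_divide eq_divide_eq mult.commute)
  have "cnj (meet_point \<zeta> \<beta>) = inverse \<zeta> + inverse \<beta> + \<zeta> * \<beta>"
    by (simp add: meet_point_def cnj)
  moreover have "meet_point \<zeta> \<beta> = \<zeta> + \<beta> + inverse \<zeta> * inverse \<beta>"
    by (simp add: meet_point_def)
  moreover have "\<zeta> * inverse \<zeta> = 1" "\<beta> * inverse \<beta> = 1" using nz by simp_all
  ultimately have "\<eta> ^ 3 - meet_point \<zeta> \<beta> * \<eta> ^ 2 + cnj (meet_point \<zeta> \<beta>) * \<eta> - 1
      = (\<eta> - \<zeta>) * (\<eta> - \<beta>) * (\<eta> - inverse \<zeta> * inverse \<beta>)"
    by algebra
  also have "inverse \<zeta> * inverse \<beta> = inverse (\<zeta> * \<beta>)" by simp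
  finally have "\<eta> ^ 3 - meet_point \<zeta> \<beta> * \<eta> ^ 2 + cnj (meet_point \<zeta> \<beta>) * \<eta> - 1
      = (\<eta> - \<zeta>) * (\<eta> - \<beta>) * (\<eta> - inverse (\<zeta> * \<beta>))" .
  then show ?thesis by (auto simp: incident_def)
qed

lemma eq_meet_point:
  assumes "\<zeta> \<in> unity_roots n" "\<beta> \<in> unity_roots n" "\<zeta> \<noteq> \<beta>" "incident \<zeta> u" "incident \<beta> u"
  shows "u = meet_point \<zeta> \<beta>"
proof -
  have nz: "\<zeta> * \<beta> \<noteq> 0" using unity_roots_nonzero[OF n] assms(1,2) by simp
  \<comment> \<open>Eliminate \<open>cnj u\<close>: take \<open>\<beta>\<close> times the cubic for
    \<open>\<zeta>\<close> minus \<open>\<zeta>\<close> times the cubic for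
    \<open>\<beta>\<close>.\<close>
  have "(\<zeta> - \<beta>) * (\<zeta> * \<beta> * (\<zeta> + \<beta>) + 1 - u * (\<zeta> * \<beta>)) = 0"
    using assms(4,5) unfolding incident_def by algebra
  then have "\<zeta> * \<beta> * (\<zeta> + \<beta>) + 1 - u * (\<zeta> * \<beta>) = 0" using assms(3) by simp
  moreover have "(\<zeta> * \<beta>) * inverse (\<zeta> * \<beta>) = 1" using nz by (rule right_inverse)
  ultimately have "(\<zeta> * \<beta>) * (u - meet_point \<zeta> \<beta>) = 0" unfolding meet_point_def by algebra
  then show ?thesis using nz by simp
qed

lemma inverse_mult_mem_unity_roots:
  "\<zeta> \<in> unity_roots n \<Longrightarrow> \<beta> \<in> unity_roots n \<Longrightarrow> inverse (\<zeta> * \<beta>) \<in> unity_roots n"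
  by (simp add: unity_roots_def power_inverse power_mult_distrib del: inverse_mult_distrib)

text \<open>With at least three roots available, some \<open>\<beta>\<close> avoids both
  \<open>\<eta>\<close> and \<open>inverse (\<zeta> * \<eta>)\<close>; the meeting point of
  \<open>\<zeta>\<close> and \<open>\<beta>\<close> then lies on the line of \<open>\<zeta>\<close>
  but not on that of \<open>\<eta>\<close>.\<close>

lemma inj_on_incident_points:
  assumes "3 \<le> n" shows "inj_on incident_points (unity_roots n)"
proof (rule inj_onI, rule ccontr)
  fix \<zeta> \<eta> assume *: "\<zeta> \<in> unity_roots n" "\<eta> \<in> unity_roots n"
    "incident_points \<zeta> = incident_points \<eta>" "\<zeta> \<noteq> \<eta>"
  have "card {\<eta>, inverse (\<zeta> * \<eta>)} \<le> 2" by (rule card_insert_le_m1) auto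
  then have "\<not> unity_roots n \<subseteq> {\<eta>, inverse (\<zeta> * \<eta>)}"
    using card_mono[of "{\<eta>, inverse (\<zeta> * \<eta>)}" "unity_roots n"] card_unity_roots[OF n] assms by auto
  then obtain \<beta> where \<beta>: "\<beta> \<in> unity_roots n" "\<beta> \<noteq> \<eta>" "\<beta> \<noteq> inverse (\<zeta> * \<eta>)" by blast
  have nz: "\<zeta> \<noteq> 0" "\<beta> \<noteq> 0" "\<eta> \<noteq> 0" using unity_roots_nonzero[OF n] * \<beta> by auto
  define p where "p = (Re (meet_point \<zeta> \<beta>), Im (meet_point \<zeta> \<beta>))"
  have "p \<in> incident_points \<zeta>"
    using incident_meet_point[OF *(1) \<beta>(1)] by (simp add: incident_points_def p_def complex_of_point_Re_Im)
  then have "incident \<eta> (meet_point \<zeta> \<beta>)"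
    unfolding *(3) by (simp add: incident_points_def p_def complex_of_point_Re_Im)
  then have "\<eta> = inverse (\<zeta> * \<beta>)"
    using incident_meet_point[OF *(1) \<beta>(1)] *(4) \<beta>(2) by auto
  then have "\<eta> * (\<zeta> * \<beta>) = 1" using nz by (metis left_inverse mult_eq_0_iff)
  then have "(\<zeta> * \<eta>) * \<beta> = 1" by (simp only: mult_ac)
  then show False using \<beta>(3) inverse_unique by blast
qed

lemma triple_points_eq:
  assumes "3 \<le> n"
  shows "triple_points n = {p. card {\<zeta> \<in> unity_roots n. incident \<zeta> (complex_of_point p)} = 3}"
proof -
  have "{L \<in> boroczky_lines n. p \<in> L} = incident_points ` {\<zeta> \<in> unity_roots n. incident \<zeta> (complex_of_point p)}" for p
    by (auto simp: boroczky_lines_eq[OF n] incident_points_def)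
  moreover have "inj_on incident_points {\<zeta> \<in> unity_roots n. incident \<zeta> (complex_of_point p)}" for p
    by (rule inj_on_subset[OF inj_on_incident_points[OF assms]]) auto
  ultimately show ?thesis by (simp add: triple_points_def card_image)
qed

lemma finite_triple_points:
  assumes "3 \<le> n" shows "finite (triple_points n)"
proof (rule finite_imageD)
  have "complex_of_point ` triple_points n
      \<subseteq> (\<lambda>(\<zeta>, \<beta>). meet_point \<zeta> \<beta>) ` (unity_roots n \<times> unity_roots n)"
  proof (rule image_subsetI)
    fix p assume "p \<in> triple_points n"
    then have "card {\<zeta> \<in> unity_roots n. incident \<zeta> (complex_of_point p)} = 3"
      by (simp add: triple_points_eq[OF assms])
    then obtain \<zeta> \<beta> \<gamma> where "{\<zeta> \<in> unity_roots n. incident \<zeta> (complex_of_point p)} = {\<zeta>, \<beta>, \<gamma>}" "\<zeta> \<noteq> \<beta>"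
      unfolding card_3_iff by blast
    then have "\<zeta> \<in> unity_roots n" "incident \<zeta> (complex_of_point p)"
      "\<beta> \<in> unity_roots n" "incident \<beta> (complex_of_point p)" "\<zeta> \<noteq> \<beta>"
      by blast+
    then show "complex_of_point p \<in> (\<lambda>(\<zeta>, \<beta>). meet_point \<zeta> \<beta>) ` (unity_roots n \<times> unity_roots n)"
      using eq_meet_point[of \<zeta> \<beta>] by (intro image_eqI[of _ _ "(\<zeta>, \<beta>)"]) simp_all
  qed
  then show "finite (complex_of_point ` triple_points n)"
    by (rule finite_subset) (simp add: finite_unity_roots[OF n])
  show "inj_on complex_of_point (triple_points n)"
    by (rule inj_on_subset[OF inj_complex_of_point]) simp
qed

text \<open>The triple points on the line of \<open>\<zeta>\<close> are the \<open>meet_point \<zeta> \<beta>\<close> with \<open>\<zeta>\<close>, \<open>\<beta>\<close> and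
  \<open>(\<zeta>\<beta>)\<^sup>-\<^sup>1\<close> distinct; this excludes at most four values of \<open>\<beta>\<close>, and \<open>\<beta>\<close> and \<open>(\<zeta>\<beta>)\<^sup>-\<^sup>1\<close> give the
  same point.\<close>

lemma card_triple_points_on_line:
  assumes "3 \<le> n" and \<zeta>: "\<zeta> \<in> unity_roots n"
  shows "n \<le> 2 * card {p \<in> triple_points n. incident \<zeta> (complex_of_point p)} + 4"
proof -
  let ?T = "{p \<in> triple_points n. incident \<zeta> (complex_of_point p)}"
  \<comment> \<open>The removed values are the coincidences \<open>\<beta> = \<zeta>\<close>,
    \<open>inverse (\<zeta> * \<beta>) = \<zeta>\<close> and
    \<open>inverse (\<zeta> * \<beta>) = \<beta>\<close>; the last is a square root condition,
    collected in \<open>S\<close>.\<close>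
  define S where "S = {\<beta>. \<beta> ^ 2 = inverse \<zeta>}"
  define B where "B = unity_roots n - ({\<zeta>, inverse (\<zeta> ^ 2)} \<union> S)"
  define f where "f \<beta> = (Re (meet_point \<zeta> \<beta>), Im (meet_point \<zeta> \<beta>))" for \<beta>
  have z0: "\<zeta> \<noteq> 0" using unity_roots_nonzero[OF n \<zeta>] .
  have S_sub: "S \<subseteq> {\<gamma>, - \<gamma>}" if "\<gamma> \<in> S" for \<gamma>
  proof
    fix \<beta> assume "\<beta> \<in> S"
    then have "\<beta> ^ 2 = \<gamma> ^ 2" using that by (simp add: S_def)
    then show "\<beta> \<in> {\<gamma>, - \<gamma>}" by (simp add: power2_eq_iff)
  qed
  have S: "finite S \<and> card S \<le> 2"
  proof (cases "S = {}")
    case False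
    then obtain \<gamma> where \<gamma>: "\<gamma> \<in> S" by blast
    have "card {\<gamma>, - \<gamma>} \<le> 2" by (rule card_insert_le_m1) auto
    then show ?thesis
      using card_mono[OF _ S_sub[OF \<gamma>]] finite_subset[OF S_sub[OF \<gamma>]] by auto
  qed simp
  have "card {\<zeta>, inverse (\<zeta> ^ 2)} \<le> 2" by (rule card_insert_le_m1) auto
  then have "card ({\<zeta>, inverse (\<zeta> ^ 2)} \<union> S) \<le> 4"
    using card_Un_le[of "{\<zeta>, inverse (\<zeta> ^ 2)}" S] S by linarith
  moreover have "card (unity_roots n) - card ({\<zeta>, inverse (\<zeta> ^ 2)} \<union> S) \<le> card B"
    unfolding B_def using S by (intro diff_card_le_card_Diff) auto
  ultimately have cardB: "n \<le> card B + 4" by (simp add: card_unity_roots[OF n])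
  have finB: "finite B" unfolding B_def by (simp add: finite_unity_roots[OF n])
  have fB: "f ` B \<subseteq> ?T"
  proof (rule image_subsetI)
    fix \<beta> assume "\<beta> \<in> B"
    then have \<beta>: "\<beta> \<in> unity_roots n" "\<beta> \<noteq> \<zeta>" "\<beta> \<noteq> inverse (\<zeta> ^ 2)" "\<beta> ^ 2 \<noteq> inverse \<zeta>"
      by (auto simp: B_def S_def)
    have b0: "\<beta> \<noteq> 0" using unity_roots_nonzero[OF n \<beta>(1)] .
    have "{\<eta> \<in> unity_roots n. incident \<eta> (meet_point \<zeta> \<beta>)} = {\<zeta>, \<beta>, inverse (\<zeta> * \<beta>)}"
      using incident_meet_point[OF \<zeta> \<beta>(1)] inverse_mult_mem_unity_roots[OF \<zeta> \<beta>(1)] \<zeta> \<beta>(1) by auto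
    moreover have "inverse (\<zeta> * \<beta>) \<noteq> \<zeta>"
    proof
      assume "inverse (\<zeta> * \<beta>) = \<zeta>"
      then have "\<zeta> * (\<zeta> * \<beta>) = 1" using z0 b0 by (metis left_inverse mult_eq_0_iff)
      then have "\<zeta> ^ 2 * \<beta> = 1" by (simp only: power2_eq_square mult_ac)
      then show False using \<beta>(3) inverse_unique by blast
    qed
    moreover have "inverse (\<zeta> * \<beta>) \<noteq> \<beta>"
    proof
      assume "inverse (\<zeta> * \<beta>) = \<beta>"
      then have "\<beta> * (\<zeta> * \<beta>) = 1" using z0 b0 by (metis left_inverse mult_eq_0_iff)
      then have "\<zeta> * \<beta> ^ 2 = 1" by (simp only: power2_eq_square mult_ac)
      then show False using \<beta>(4) inverse_unique by metis
    qed
    ultimately have "card {\<eta> \<in> unity_roots n. incident \<eta> (meet_point \<zeta> \<beta>)} = 3"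
      using \<beta>(2) by auto
    then show "f \<beta> \<in> ?T"
      using incident_meet_point[OF \<zeta> \<beta>(1)]
      by (simp add: triple_points_eq[OF assms(1)] f_def complex_of_point_Re_Im)
  qed
  have fib: "card {\<beta> \<in> B. f \<beta> = y} \<le> 2" if y: "y \<in> f ` B" for y
  proof -
    obtain \<beta> where \<beta>: "\<beta> \<in> B" "y = f \<beta>" using y by blast
    have "{\<gamma> \<in> B. f \<gamma> = y} \<subseteq> {\<beta>, inverse (\<zeta> * \<beta>)}"
    proof
      fix \<gamma> assume \<gamma>: "\<gamma> \<in> {\<gamma> \<in> B. f \<gamma> = y}"
      then have "meet_point \<zeta> \<gamma> = meet_point \<zeta> \<beta>" using \<beta> by (simp add: f_def complex_eq_iff)
      then have "incident \<gamma> (meet_point \<zeta> \<beta>)"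
        using incident_meet_point[OF \<zeta>, of \<gamma> \<gamma>] \<gamma> by (simp add: B_def)
      then show "\<gamma> \<in> {\<beta>, inverse (\<zeta> * \<beta>)}"
        using incident_meet_point[OF \<zeta>, of \<beta> \<gamma>] \<gamma> \<beta> by (auto simp: B_def)
    qed
    then have "card {\<gamma> \<in> B. f \<gamma> = y} \<le> card {\<beta>, inverse (\<zeta> * \<beta>)}"
      by (intro card_mono) auto
    also have "\<dots> \<le> 2" by (rule card_insert_le_m1) auto
    finally show ?thesis .
  qed
  have "card B = (\<Sum>y\<in>f ` B. card {\<beta> \<in> B. f \<beta> = y})"
    using sum.image_gen[OF finB, of "\<lambda>_. 1::nat" f] by (simp only: card_eq_sum)
  also have "\<dots> \<le> 2 * card (f ` B)"
    using sum_bounded_above[of "f ` B" "\<lambda>y. card {\<beta> \<in> B. f \<beta> = y}" 2] fib by (simp add: mult.commute)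
  also have "\<dots> \<le> 2 * card ?T"
    using card_mono[OF _ fB] finite_triple_points[OF assms(1)] by simp
  finally show ?thesis using cardB by linarith
qed

end

subsection \<open>Multiplicities and degrees of bivariate polynomials\<close>

lemma ring_map_poly_eqI:
  fixes \<phi> :: "'a::comm_ring_1 poly \<Rightarrow> 'b::comm_ring_1"
  assumes "ring_map \<phi>" "ring_map \<psi>" "\<And>a. \<phi> [:a:] = \<psi> [:a:]" "\<phi> [:0, 1:] = \<psi> [:0, 1:]"
  shows "\<phi> p = \<psi> p"
proof (induction p)
  case 0
  then show ?case using assms by (simp add: ring_map.map_zero)
next
  case (pCons a p)
  have "pCons a p = [:a:] + [:0, 1:] * p" by simp
  then show ?case
    using pCons assms by (simp only: ring_map.map_add ring_map.map_mult)
qed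

lemma ring_map_dvd: "ring_map \<phi> \<Longrightarrow> a dvd b \<Longrightarrow> \<phi> a dvd \<phi> b"
  by (auto simp: ring_map.map_mult elim!: dvdE)

lemma ring_map_pcompose: "ring_map (\<lambda>p. pcompose p q)"
  by (simp add: ring_map_def pcompose_add pcompose_mult pcompose_1)

text \<open>Stated over any domain because the coefficients will lie in
  \<open>\<complex>[u]\<close>, where a root of a polynomial in \<open>v\<close> is a line contained
  in the curve.\<close>

lemma prod_linear_dvd:
  fixes p :: "'a::idom poly"
  assumes "finite A" "\<And>x. x \<in> A \<Longrightarrow> poly p x = 0"
  shows "(\<Prod>x\<in>A. [:- x, 1:]) dvd p"
  using assms
proof (induction A arbitrary: p rule: finite_induct)
  case (insert x A)
  then have "[:- x, 1:] dvd p" by (simp add: poly_eq_0_iff_dvd[symmetric])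
  then obtain q where q: "p = [:- x, 1:] * q" by (rule dvdE)
  have "poly q y = 0" if "y \<in> A" for y
    using insert.prems[of y] insert.hyps that by (auto simp: q)
  then have "(\<Prod>x\<in>A. [:- x, 1:]) dvd q" by (rule insert.IH)
  then show ?case using insert.hyps by (simp add: q mult_dvd_mono del: mult_pCons_left)
qed simp

text \<open>The univariate core of the Bezout argument: the orders at the points of \<open>A\<close>
  sum to at least \<open>m * card A\<close>, while all orders together are bounded by the
  degree.\<close>

lemma eq_0_if_many_roots:
  fixes h :: "'a::idom poly"
  assumes "finite A" "\<And>a. a \<in> A \<Longrightarrow> [:- a, 1:] ^ m dvd h" "degree h < m * card A"
  shows "h = 0"
proof (rule ccontr)
  assume "h \<noteq> 0"
  have "m * card A \<le> (\<Sum>a\<in>A. order a h)"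
    using sum_bounded_below[of A m "\<lambda>a. order a h"] assms(2) \<open>h \<noteq> 0\<close>
    by (auto simp: order_divides mult.commute)
  also have "\<dots> \<le> degree h"
  proof (cases "m = 0")
    case False
    have "A \<subseteq> {x. poly h x = 0}"
    proof
      fix a assume "a \<in> A"
      then have "m \<le> order a h" using assms(2) \<open>h \<noteq> 0\<close> by (simp add: order_divides)
      then show "a \<in> {x. poly h x = 0}" using False \<open>h \<noteq> 0\<close> by (simp add: order_root)
    qed
    then have "(\<Sum>a\<in>A. order a h) \<le> (\<Sum>a | poly h a = 0. order a h)"
      using poly_roots_finite[OF \<open>h \<noteq> 0\<close>] by (intro sum_mono2) auto
    also have "\<dots> \<le> degree h" by (rule sum_order_le_degree[OF \<open>h \<noteq> 0\<close>])
    finally show ?thesis .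
  qed (use assms(3) in simp)
  finally show False using assms(3) by simp
qed

text \<open>For \<open>g\<close> in \<open>\<complex>[u][v]\<close> this is \<open>g (a + t, b + w t)\<close> in \<open>\<complex>[w][t]\<close>. Its order in \<open>t\<close> is the multiplicity
  of \<open>g\<close> at \<open>(a, b)\<close> and its degree in \<open>t\<close> is the total degree of \<open>g\<close>, so both are additive on products.\<close>

definition blowup :: "complex \<Rightarrow> complex \<Rightarrow> complex poly poly \<Rightarrow> complex poly poly" where
  "blowup a b = poly_subst (poly_subst (\<lambda>x. [:[:x:]:]) [:[:a:], 1:]) [:[:b:], [:0, 1:]:]"

lemma ring_map_const_poly2: "ring_map (\<lambda>x. [:[:x:]:])"
  by (rule ring_map_comp[OF ring_map_const_poly ring_map_const_poly])

lemma ring_map_blowup: "ring_map (blowup a b)"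
  unfolding blowup_def by (intro ring_map_poly_subst ring_map_const_poly2)

lemma blowup_pCons:
  "blowup a b (pCons q g) = poly_subst (\<lambda>x. [:[:x:]:]) [:[:a:], 1:] q + [:[:b:], [:0, 1:]:] * blowup a b g"
  unfolding blowup_def by (rule poly_subst_pCons[OF ring_map_poly_subst[OF ring_map_const_poly2]])

lemmas blowup_simps =
  blowup_pCons poly_subst_pCons[OF ring_map_const_poly2] ring_map.map_zero[OF ring_map_blowup]
  ring_map.map_one[OF ring_map_poly_subst[OF ring_map_const_poly2]]

text \<open>The image has degree 1 in \<open>t\<close>, since its leading coefficient
  \<open>w - \<zeta>\<close> is nonzero, and is divisible by \<open>t\<close> exactly when
  \<open>(a, b)\<close> lies on the line.\<close>

lemma blowup_line:
  "blowup a b [:- [:\<beta>, \<zeta>:], 1:] = [:[:b - (\<beta> + \<zeta> * a):], [:- \<zeta>, 1:]:]"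
  by (simp add: blowup_simps pCons_one[symmetric] algebra_simps)

text \<open>Setting \<open>w = \<alpha>\<close> makes \<open>(a + t, b + w t)\<close> run along the
  line of slope \<open>\<alpha>\<close> through \<open>(a, b)\<close>. Both sides are ring
  homomorphisms in \<open>g\<close>, so the generators suffice.\<close>

lemma blowup_restrict_line:
  "map_poly (\<lambda>q. poly q \<alpha>) (blowup a b g) = pcompose (poly g [:b - \<alpha> * a, \<alpha>:]) [:a, 1:]"
proof (rule ring_map_poly_eqI[where p = g])
  let ?\<phi> = "\<lambda>g. map_poly (\<lambda>q. poly q \<alpha>) (blowup a b g)"
  let ?\<psi> = "\<lambda>g. pcompose (poly g [:b - \<alpha> * a, \<alpha>:]) [:a, 1:]"
  show "ring_map ?\<phi>"
    by (rule ring_map_comp[OF ring_map_blowup ring_map_map_poly[OF ring_map_poly]])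
  show "ring_map ?\<psi>"
    by (rule ring_map_comp[OF ring_map_poly ring_map_pcompose])
  show "?\<phi> [:p:] = ?\<psi> [:p:]" for p
  proof (rule ring_map_poly_eqI[where p = p])
    show "ring_map (\<lambda>p. ?\<phi> [:p:])"
      by (rule ring_map_comp[OF ring_map_const_poly \<open>ring_map ?\<phi>\<close>])
    show "ring_map (\<lambda>p. ?\<psi> [:p:])"
      by (rule ring_map_comp[OF ring_map_const_poly \<open>ring_map ?\<psi>\<close>])
  qed (simp_all add: blowup_simps map_poly_pCons pcompose_pCons)
  show "?\<phi> [:0, 1:] = ?\<psi> [:0, 1:]"
    by (simp add: blowup_simps map_poly_pCons pcompose_pCons)
qed

text \<open>Specializing \<open>w\<close> to the slope keeps divisibility by powers of
  \<open>t\<close>, and the shift by \<open>a\<close> turns \<open>t\<close> into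
  \<open>u - a\<close>.\<close>

lemma line_section_dvd:
  assumes "[:0, 1:] ^ m dvd blowup a (\<beta> + \<zeta> * a) g"
  shows "[:- a, 1:] ^ m dvd poly g [:\<beta>, \<zeta>:]"
proof -
  interpret spec: ring_map "map_poly (\<lambda>q. poly q \<zeta>)" by (rule ring_map_map_poly[OF ring_map_poly])
  interpret shift: ring_map "\<lambda>p. pcompose p [:- a, 1:]" by (rule ring_map_pcompose)
  have "[:0, 1:] ^ m dvd pcompose (poly g [:\<beta>, \<zeta>:]) [:a, 1:]"
    using ring_map_dvd[OF spec.ring_map_axioms assms]
    by (simp add: spec.map_power blowup_restrict_line map_poly_pCons)
  from ring_map_dvd[OF shift.ring_map_axioms this]
  show ?thesis
    by (simp add: shift.map_power pcompose_pCons pcompose_assoc[symmetric] pcompose_idR)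
qed

lemma degree_line_section_le:
  "degree (poly g [:\<beta>, \<zeta>:]) \<le> degree (blowup 0 \<beta> g)"
proof -
  have "poly g [:\<beta>, \<zeta>:] = map_poly (\<lambda>q. poly q \<zeta>) (blowup 0 \<beta> g)"
    by (simp add: blowup_restrict_line pcompose_idR)
  then show ?thesis by (auto intro!: degree_le simp: coeff_map_poly coeff_eq_0)
qed

text \<open>The descent for lines \<open>v = \<beta> \<zeta> + \<zeta> u\<close> indexed by
  \<open>W\<close> and points \<open>Q\<close>. Each line carries enough points of multiplicity
  \<open>m\<close> to be a component; removing all \<open>n\<close> lines lowers the degree by
  \<open>n\<close> and the multiplicities by at most 3, which preserves
  \<open>3 * d < m * n\<close>.\<close>

lemma blowup_eq_0_if_small_degree:
  fixes \<beta> :: "complex \<Rightarrow> complex"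
  assumes W: "finite W" "card W = n" "12 \<le> n"
    and Q: "finite Q"
    and triple: "\<And>a b. (a, b) \<in> Q \<Longrightarrow> card {\<zeta>\<in>W. b = \<beta> \<zeta> + \<zeta> * a} \<le> 3"
    and many: "\<And>\<zeta>. \<zeta> \<in> W \<Longrightarrow> n \<le> 2 * card {(a, b)\<in>Q. b = \<beta> \<zeta> + \<zeta> * a} + 4"
    and mult: "\<And>a b. (a, b) \<in> Q \<Longrightarrow> [:0, 1:] ^ m dvd blowup a b g"
    and deg: "\<And>a b. degree (blowup a b g) \<le> d"
    and less: "3 * d < m * n"
  shows "blowup 0 0 g = 0"
  using mult deg less
proof (induction m arbitrary: d g rule: less_induct)
  case (less m)
  note mult = less.prems(1) and deg = less.prems(2)
  have "0 < m" using less.prems(3) by (cases m) auto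
  have root: "poly g [:\<beta> \<zeta>, \<zeta>:] = 0" if "\<zeta> \<in> W" for \<zeta>
  proof (rule eq_0_if_many_roots[where m = m])
    let ?P = "{(a, b)\<in>Q. b = \<beta> \<zeta> + \<zeta> * a}"
    have finP: "finite ?P" by (rule finite_subset[OF _ Q]) auto
    have "inj_on fst ?P" by (auto simp: inj_on_def)
    then have card: "card (fst ` ?P) = card ?P" by (rule card_image)
    show "finite (fst ` ?P)" using finP by simp
    show "[:- a, 1:] ^ m dvd poly g [:\<beta> \<zeta>, \<zeta>:]" if "a \<in> fst ` ?P" for a
      using that by (auto intro!: line_section_dvd mult)
    \<comment> \<open>Here \<open>12 \<le> n\<close> enters: for \<open>c\<close> points on the
      line, \<open>n \<le> 2 * c + 4\<close> gives
      \<open>6 * c \<ge> 3 * n - 12 \<ge> 2 * n\<close>.\<close>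
    have "n \<le> 3 * card ?P" using many[OF \<open>\<zeta> \<in> W\<close>] W(3) by linarith
    then have "m * n \<le> m * (3 * card ?P)" by (rule mult_left_mono) simp
    then have "d < m * card ?P" using less.prems(3) unfolding mult.left_commute[of m 3] by linarith
    then show "degree (poly g [:\<beta> \<zeta>, \<zeta>:]) < m * card (fst ` ?P)"
      using degree_line_section_le[of g "\<beta> \<zeta>" \<zeta>] deg[of 0 "\<beta> \<zeta>"] by (simp add: card)
  qed
  define L where "L = (\<Prod>\<zeta>\<in>W. [:- [:\<beta> \<zeta>, \<zeta>:], 1:])"
  \<comment> \<open>Distinct slopes give distinct roots in \<open>v\<close>, so the product of all
    line factors divides \<open>g\<close>.\<close>
  have "inj_on (\<lambda>\<zeta>. [:\<beta> \<zeta>, \<zeta>:]) W" by (auto simp: inj_on_def)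
  then have "L = (\<Prod>r\<in>(\<lambda>\<zeta>. [:\<beta> \<zeta>, \<zeta>:]) ` W. [:- r, 1:])"
    by (simp add: L_def prod.reindex)
  moreover have "(\<Prod>r\<in>(\<lambda>\<zeta>. [:\<beta> \<zeta>, \<zeta>:]) ` W. [:- r, 1:]) dvd g"
    using root W(1) by (intro prod_linear_dvd) auto
  ultimately obtain G where G: "g = L * G" by (auto elim: dvdE)
  have bl: "blowup a b L = (\<Prod>\<zeta>\<in>W. [:[:b - (\<beta> \<zeta> + \<zeta> * a):], [:- \<zeta>, 1:]:])" for a b
    by (simp only: L_def ring_map.map_prod[OF ring_map_blowup] blowup_line)
  have L_nz: "blowup a b L \<noteq> 0" for a b
    unfolding bl using W(1) by (simp add: prod_zero_iff)
  have L_deg: "degree (blowup a b L) = n" for a b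
    unfolding bl by (subst degree_prod_eq_sum_degree) (auto simp: W(2))
  \<comment> \<open>Each factor has order at most 1, and order 0 unless its line passes through the
    point, where at most three lines meet.\<close>
  have L_ord: "order 0 (blowup a b L) \<le> 3" if "(a, b) \<in> Q" for a b
  proof -
    have "order 0 (\<Prod>\<zeta>\<in>A. [:[:b - (\<beta> \<zeta> + \<zeta> * a):], [:- \<zeta>, 1:]:])
        \<le> card {\<zeta>\<in>A. b = \<beta> \<zeta> + \<zeta> * a}" if "finite A" for A
      using that
    proof (induction A rule: finite_induct)
      case (insert \<zeta> A)
      let ?l = "[:[:b - (\<beta> \<zeta> + \<zeta> * a):], [:- \<zeta>, 1:]:]"
      have "order 0 ?l \<le> (if b = \<beta> \<zeta> + \<zeta> * a then 1 else 0)"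
        using order_degree[of ?l 0] order_0I[of ?l 0] by auto
      moreover have "{\<eta>\<in>insert \<zeta> A. b = \<beta> \<eta> + \<eta> * a}
          = (if b = \<beta> \<zeta> + \<zeta> * a then insert \<zeta> else id) {\<eta>\<in>A. b = \<beta> \<eta> + \<eta> * a}"
        by auto
      moreover have "(\<Prod>\<zeta>\<in>insert \<zeta> A. [:[:b - (\<beta> \<zeta> + \<zeta> * a):], [:- \<zeta>, 1:]:]) \<noteq> 0"
        unfolding prod_zero_iff[OF finite.insertI[OF insert.hyps(1)]] by simp
      ultimately show ?case
        using insert by (auto simp: order_mult simp del: mult_pCons_left split: if_splits)
    qed simp
    from this[OF W(1)] show ?thesis using triple[OF that] unfolding bl by linarith
  qed
  have bG: "blowup a b g = blowup a b L * blowup a b G" for a b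
    by (simp add: G ring_map.map_mult[OF ring_map_blowup])
  show ?case
  proof (rule ccontr)
    assume nz: "blowup 0 0 g \<noteq> 0"
    then have "blowup 0 0 G \<noteq> 0" by (auto simp: bG)
    then have "degree (blowup 0 0 g) = n + degree (blowup 0 0 G)"
      using L_nz L_deg by (simp add: bG degree_mult_eq)
    \<comment> \<open>A nonzero multiple of the product of all lines has degree at least
      \<open>n\<close>. Then \<open>3 * n \<le> 3 * d < m * n\<close> forces \<open>3 < m\<close>,
      so neither \<open>d - n\<close> nor \<open>m - 3\<close> is truncated.\<close>
    then have "n \<le> d" using deg[of 0 0] by linarith
    then have "3 * n < m * n" using less.prems(3) by linarith
    then have "3 < m" by simp
    have "blowup 0 0 G = 0"
    proof (rule less.IH[of "m - 3" G "d - n"])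
      show "m - 3 < m" using \<open>0 < m\<close> by simp
      show "3 * (d - n) < (m - 3) * n"
        using less.prems(3) \<open>n \<le> d\<close> \<open>3 < m\<close> by (simp add: diff_mult_distrib)
      show "degree (blowup a b G) \<le> d - n" for a b
      proof (cases "blowup a b G = 0")
        case False
        then show ?thesis
          using deg[of a b] L_nz L_deg by (simp add: bG degree_mult_eq)
      qed simp
      show "[:0, 1:] ^ (m - 3) dvd blowup a b G" if "(a, b) \<in> Q" for a b
      proof (cases "blowup a b G = 0")
        case False
        then have "m \<le> order 0 (blowup a b L) + order 0 (blowup a b G)"
          using mult[OF that] L_nz order_divides[of 0 m "blowup a b g"] by (simp add: bG order_mult)
        then have "m - 3 \<le> order 0 (blowup a b G)" using L_ord[OF that] by linarith
        then show ?thesis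
          using order_divides[of 0 "m - 3" "blowup a b G"] by simp
      qed simp
    qed
    then show False using nz by (simp add: bG)
  qed
qed

subsection \<open>Nonvanishing of polynomials\<close>

text \<open>Uniqueness of digits in base \<open>N\<close>; the leading digit may be arbitrarily
  large.\<close>

lemma base_expansion_unique:
  fixes N :: nat
  assumes "a < N" "b < N" "a' < N" "b' < N"
    and "a + N * b + N ^ 2 * c = a' + N * b' + N ^ 2 * c'"
  shows "a = a' \<and> b = b' \<and> c = c'"
proof -
  have N: "0 < N" using assms(1) by simp
  have eq: "a + N * (b + N * c) = a' + N * (b' + N * c')"
    using assms(5) by (simp add: power2_eq_square algebra_simps)
  have "a = (a + N * (b + N * c)) mod N" using assms(1) by simp
  also have "\<dots> = a'" unfolding eq using assms(3) by simp
  finally have a: "a = a'" .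
  have eq2: "b + N * c = b' + N * c'" using eq N by (simp add: a)
  have "b = (b + N * c) mod N" using assms(2) by simp
  also have "\<dots> = b'" unfolding eq2 using assms(4) by simp
  finally have "b = b'" .
  then show ?thesis using eq2 N a by simp
qed

lemma prod_UNIV_3: "(\<Prod>i\<in>(UNIV :: 3 set). g i) = g 1 * g 2 * (g 3 :: 'a::comm_monoid_mult)"
  unfolding UNIV_3 by (simp add: ac_simps)

text \<open>All exponents are below \<open>N\<close>, so distinct monomials turn into distinct
  powers of one variable and no terms cancel.\<close>

lemma kronecker_substitution_nonzero:
  fixes f :: "(3, complex) polynomial"
  assumes "f \<noteq> 0" "total_degree f < N"
  shows "subst (\<lambda>a. [:a:]) (($) (vector [monom 1 1, monom 1 N, monom 1 (N ^ 2)])) f \<noteq> 0"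
proof -
  define e where "e t = Poly_Mapping.lookup t 1 + N * Poly_Mapping.lookup t 2
    + N ^ 2 * Poly_Mapping.lookup t (3 :: 3)" for t :: "3 \<Rightarrow>\<^sub>0 nat"
  have less: "Poly_Mapping.lookup t i < N" if "t \<in> Poly_Mapping.keys f" for t i
  proof -
    have "Poly_Mapping.lookup t i \<le> monomial_degree t"
      unfolding monomial_degree_def by (rule member_le_sum) auto
    then show ?thesis using monomial_degree_le_total_degree[OF that] assms(2) by linarith
  qed
  have inj: "inj_on e (Poly_Mapping.keys f)"
  proof (rule inj_onI)
    fix s t assume st: "s \<in> Poly_Mapping.keys f" "t \<in> Poly_Mapping.keys f" "e s = e t"
    then have "\<forall>i. Poly_Mapping.lookup s i = Poly_Mapping.lookup t i"
      unfolding forall_3 e_def using base_expansion_unique less by meson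
    then show "s = t" by (simp add: poly_mapping_eqI)
  qed
  have eq: "subst (\<lambda>a. [:a:]) (($) (vector [monom 1 1, monom 1 N, monom 1 (N ^ 2)])) f
      = (\<Sum>t\<in>Poly_Mapping.keys f. monom (Poly_Mapping.lookup f t) (e t))"
    unfolding subst_def
  proof (rule sum.cong)
    fix t
    have "(\<Prod>i\<in>UNIV. vector [monom 1 1, monom 1 N, monom 1 (N ^ 2)] $ i ^ Poly_Mapping.lookup t i)
        = (monom 1 (e t) :: complex poly)"
      unfolding prod_UNIV_3 vector_3 monom_power mult_monom e_def by simp
    then show "[:Poly_Mapping.lookup f t:] * (\<Prod>i\<in>UNIV. vector [monom 1 1, monom 1 N, monom 1 (N ^ 2)] $ i
        ^ Poly_Mapping.lookup t i) = monom (Poly_Mapping.lookup f t) (e t)"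
      by (simp add: smult_monom)
  qed simp
  have "Poly_Mapping.keys f \<noteq> {}"
  proof
    assume "Poly_Mapping.keys f = {}"
    then have "(\<Sum>t\<in>Poly_Mapping.keys f. Poly_Mapping.single t (Poly_Mapping.lookup f t)) = 0" by simp
    then show False using assms(1) unfolding poly_mapping_sum_single by simp
  qed
  then obtain t where t: "t \<in> Poly_Mapping.keys f" by blast
  have "coeff (\<Sum>t\<in>Poly_Mapping.keys f. monom (Poly_Mapping.lookup f t) (e t)) (e t)
      = (\<Sum>s\<in>Poly_Mapping.keys f. if s = t then Poly_Mapping.lookup f t else 0)"
    unfolding coeff_sum using inj t by (intro sum.cong) (auto simp: inj_on_def)
  also have "\<dots> = Poly_Mapping.lookup f t" using t by simp
  also have "\<dots> \<noteq> 0" using t by (simp add: in_keys_iff)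
  finally show ?thesis unfolding eq by auto
qed

lemma ex_nonroot:
  fixes p :: "complex poly"
  assumes "p \<noteq> 0" shows "\<exists>x. poly p x \<noteq> 0"
proof (rule ccontr)
  assume "\<not> ?thesis"
  then have "\<forall>x. poly p x = 0" by blast
  then show False using assms by (simp only: poly_all_0_iff_0)
qed

text \<open>The side conditions place the point in the affine chart and keep its first isotropic
  coordinate away from 0. Under the Kronecker substitution all three requirements become nonzero
  univariate polynomials, so a nonroot of their product works.\<close>

lemma ex_eval_poly_nonzero:
  fixes f :: "(3, complex) polynomial"
  assumes "f \<noteq> 0"
  shows "\<exists>v. eval_poly f v \<noteq> 0 \<and> v $ 3 \<noteq> 0 \<and> v $ 1 + \<i> * v $ 2 \<noteq> 0"
proof -
  \<comment> \<open>The summand 2 gives \<open>N \<ge> 2\<close>, so that the second coordinate does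
    not contribute to the linear coefficient of \<open>x + \<i> * x ^ N\<close>.\<close>
  define N where "N = total_degree f + 2"
  define K where "K = subst (\<lambda>a. [:a:]) (($) (vector [monom 1 1, monom 1 N, monom 1 (N ^ 2)])) f"
  have "coeff (monom 1 1 + monom \<i> N) 1 = 1" by (simp add: N_def)
  then have "monom 1 1 + monom \<i> N \<noteq> 0" by (metis coeff_0 zero_neq_one)
  moreover have "K \<noteq> 0" unfolding K_def by (rule kronecker_substitution_nonzero[OF assms]) (simp add: N_def)
  ultimately have "K * monom 1 1 * (monom 1 1 + monom \<i> N) \<noteq> 0" by simp
  then obtain x where x: "poly (K * monom 1 1 * (monom 1 1 + monom \<i> N)) x \<noteq> 0"
    using ex_nonroot by blast
  define v :: "complex ^ 3" where "v = vector [x, x ^ N, x ^ (N ^ 2)]"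
  have "poly (vector [monom 1 1, monom 1 N, monom 1 (N ^ 2)] $ i) x = v $ i" for i :: 3
    using exhaust_3[of i] by (auto simp: v_def vector_3 poly_monom)
  then have "poly K x = eval_poly f v"
    unfolding K_def eval_poly_eq_subst by (subst subst_comp[OF ring_map_poly]) simp
  then show ?thesis using x by (intro exI[of _ v]) (auto simp: v_def vector_3 poly_monom)
qed

subsection \<open>Dehomogenization\<close>

text \<open>The substitution \<open>(x, y, z) = c ((u + v) / 2, (u - v) / (2 \<i>), 1)\<close>.\<close>

definition isotropic_coords :: "complex \<Rightarrow> 3 \<Rightarrow> complex poly poly" where
  "isotropic_coords c = ($) (vector [[:[:0, c / 2:], [:c / 2:]:],
     [:[:0, - (\<i> * c) / 2:], [:\<i> * c / 2:]:], [:[:c:]:]])"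

text \<open>The scale \<open>c\<close> is kept free because the multipliers that define symbolic
  powers need not be homogeneous and may vanish at a point's representative with last coordinate
  1.\<close>

definition dehomogenize :: "complex \<Rightarrow> (3, complex) polynomial \<Rightarrow> complex poly poly" where
  "dehomogenize c = subst (\<lambda>a. [:[:a:]:]) (isotropic_coords c)"

definition isotropic_vec :: "complex \<Rightarrow> complex \<Rightarrow> complex ^ 3" where
  "isotropic_vec a b = vector [(a + b) / 2, - \<i> * (a - b) / 2, 1]"

lemma ring_map_dehomogenize: "ring_map (dehomogenize c)"
  unfolding dehomogenize_def by (rule ring_map_subst[OF ring_map_const_poly2])

lemma ring_map_blowup_dehomogenize: "ring_map (\<lambda>f. blowup a b (dehomogenize c f))"
  by (rule ring_map_comp[OF ring_map_dehomogenize ring_map_blowup])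

lemma blowup_dehomogenize:
  "blowup a b (dehomogenize c f) = subst (\<lambda>a. [:[:a:]:]) (\<lambda>i. blowup a b (isotropic_coords c i)) f"
proof -
  have "blowup a b [:[:x:]:] = [:[:x:]:]" for x by (simp add: blowup_simps)
  then show ?thesis
    unfolding dehomogenize_def subst_comp[OF ring_map_blowup] by (simp only:)
qed

lemma blowup_linear: "blowup a b [:[:p, q:], [:r:]:] = [:[:p + q * a + r * b:], [:q, r:]:]"
  by (simp add: blowup_simps pCons_one[symmetric] mult.commute)

lemma blowup_isotropic_coords:
  "blowup a b (isotropic_coords c i) = ($) (vector [[:[:c / 2 * a + c / 2 * b:], [:c / 2, c / 2:]:],
     [:[:- (\<i> * c) / 2 * a + \<i> * c / 2 * b:], [:- (\<i> * c) / 2, \<i> * c / 2:]:], [:[:c:]:]]) i"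
proof -
  have "blowup a b [:[:c:]:] = [:[:c:]:]" by (simp add: blowup_simps)
  then have "\<forall>i. blowup a b (isotropic_coords c i) = ($) (vector [[:[:c / 2 * a + c / 2 * b:], [:c / 2, c / 2:]:],
     [:[:- (\<i> * c) / 2 * a + \<i> * c / 2 * b:], [:- (\<i> * c) / 2, \<i> * c / 2:]:], [:[:c:]:]]) i"
    unfolding forall_3 isotropic_coords_def vector_3 blowup_linear by simp
  then show ?thesis ..
qed

lemma degree_blowup_dehomogenize_le: "degree (blowup a b (dehomogenize c f)) \<le> total_degree f"
  unfolding blowup_dehomogenize
proof (rule degree_subst_le)
  show "degree (blowup a b (isotropic_coords c i)) \<le> 1" for i
    unfolding blowup_isotropic_coords using exhaust_3[of i]
    by (elim disjE) (simp_all add: vector_3)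
qed simp

lemma poly_blowup_dehomogenize:
  "poly (poly (blowup a b (dehomogenize c f)) [:t:]) w = eval_poly f (c *s isotropic_vec (a + t) (b + w * t))"
proof -
  have ring: "h * a + h * b + t * (h + w * h) = h * (a + t + (b + w * t))"
    "- h * a + h * b + t * (- h + w * h) = - h * (a + t - (b + w * t))" for h
    by algebra+
  have "c / 2 * a + c / 2 * b + t * (c / 2 + w * (c / 2)) = c * ((a + t + (b + w * t)) / 2)"
    unfolding ring by simp
  moreover have "- (\<i> * c) / 2 * a + \<i> * c / 2 * b + t * (- (\<i> * c) / 2 + w * (\<i> * c / 2))
      = c * (- \<i> * (a + t - (b + w * t)) / 2)"
    unfolding minus_divide_left[symmetric] ring by simp
  ultimately have "\<forall>i. poly (poly (blowup a b (isotropic_coords c i)) [:t:]) w = (c *s isotropic_vec (a + t) (b + w * t)) $ i"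
    unfolding forall_3 blowup_isotropic_coords vector_3 isotropic_vec_def vector_smult_component
    by (simp only: poly_pCons poly_0 poly_add poly_mult mult_zero_right add_0_right mult_1_right simp_thms)
  then have coords: "(\<lambda>i. poly (poly (blowup a b (isotropic_coords c i)) [:t:]) w)
      = ($) (c *s isotropic_vec (a + t) (b + w * t))"
    by blast
  have "ring_map (\<lambda>g. poly (poly g [:t:]) w)"
    by (simp add: ring_map_def)
  from subst_comp[OF this, of "\<lambda>x. [:[:x:]:]" "\<lambda>i. blowup a b (isotropic_coords c i)" f]
  show ?thesis
    unfolding blowup_dehomogenize eval_poly_eq_subst coords by simp
qed

lemma poly_blowup_dehomogenize_0:
  "poly (blowup a b (dehomogenize c f)) 0 = [:eval_poly f (c *s isotropic_vec a b):]"
proof -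
  have "poly (poly (blowup a b (dehomogenize c f)) 0) w = poly [:eval_poly f (c *s isotropic_vec a b):] w" for w
    using poly_blowup_dehomogenize[of a b c f 0 w] by simp
  then show ?thesis by (simp add: poly_eq_poly_eq_iff[symmetric] fun_eq_iff)
qed

subsection \<open>The ideal of the triple points\<close>

definition affine_vec :: "real \<times> real \<Rightarrow> complex ^ 3" where
  "affine_vec p = isotropic_vec (complex_of_point p) (cnj (complex_of_point p))"

lemma affine_vec_eq: "affine_vec p = vector [of_real (fst p), of_real (snd p), 1]"
  unfolding vec_eq_iff forall_3
  by (simp add: affine_vec_def isotropic_vec_def complex_add_cnj complex_diff_cnj vector_3)
    (simp add: complex_of_point_def complex_eq_iff)

lemma affine_vec_coord: "affine_vec p $ 1 + \<i> * affine_vec p $ 2 = complex_of_point p"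
  by (simp add: affine_vec_eq vector_3 complex_of_point_def Complex_eq)

lemma boroczky_triple_points_eq:
  "boroczky_triple_points n = proj_point ` affine_vec ` triple_points n"
  by (simp add: boroczky_triple_points_def embed_plane_def affine_vec_eq image_image)

lemma cone_poly_linear_form:
  "cone_poly v (linear_form a) = [:0, a $ 1 * v $ 1 + a $ 2 * v $ 2 + a $ 3 * v $ 3:]"
  unfolding cone_poly_def by (subst subst_linear_form[OF ring_map_const_poly]) (simp add: sum_3)

text \<open>For \<open>p\<close> in the chart \<open>z = 1\<close> this is the isotropic line
  \<open>u = const\<close> through \<open>p\<close>. Its only real affine point is that of
  \<open>p\<close>, so these forms separate the triple points.\<close>

definition point_form :: "complex ^ 3 \<Rightarrow> (3, complex) polynomial" where
  "point_form p = linear_form (vector [1, \<i>, - (p $ 1 + \<i> * p $ 2)])"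

definition separator :: "nat \<Rightarrow> complex ^ 3 \<Rightarrow> (3, complex) polynomial" where
  "separator n q = (\<Prod>p\<in>affine_vec ` triple_points n - {q}. point_form p)"

lemma cone_poly_point_form_eq_0_iff:
  "cone_poly (affine_vec q) (point_form (affine_vec p)) = 0 \<longleftrightarrow> affine_vec p = affine_vec q"
proof -
  have "affine_vec q $ 3 = 1" by (simp add: affine_vec_eq vector_3)
  then have "cone_poly (affine_vec q) (point_form (affine_vec p)) = [:0, (affine_vec q $ 1 + \<i> * affine_vec q $ 2)
      - (affine_vec p $ 1 + \<i> * affine_vec p $ 2):]"
    by (simp add: point_form_def cone_poly_linear_form vector_3)
  also have "\<dots> = 0 \<longleftrightarrow> complex_of_point q = complex_of_point p"
    unfolding affine_vec_coord by simp
  also have "\<dots> \<longleftrightarrow> affine_vec p = affine_vec q"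
    by (metis affine_vec_coord affine_vec_def)
  finally show ?thesis .
qed

section \<open>Membership in the symbolic powers\<close>

context
  fixes n :: nat
  assumes n: "3 \<le> n"
begin

private abbreviation (input) "V \<equiv> affine_vec ` triple_points n"
private abbreviation (input) "J \<equiv> homogeneous_ideal (boroczky_triple_points n)"

lemma homogeneous_ideal_boroczky: "J = {f. \<forall>q\<in>V. cone_poly q f = 0}"
  unfolding boroczky_triple_points_eq by (rule homogeneous_ideal_proj_points)

lemma finite_affine_vec_triple_points: "finite V"
  using finite_triple_points[of n] n by simp

lemma separator_nonzero:
  assumes "q \<in> V" shows "cone_poly q (separator n q) \<noteq> 0"
proof -
  have "cone_poly q (point_form p) \<noteq> 0" if "p \<in> V - {q}" for p
    using that assms cone_poly_point_form_eq_0_iff by blast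
  then show ?thesis
    unfolding separator_def ring_map.map_prod[OF ring_map_cone_poly]
    using finite_affine_vec_triple_points by (simp add: prod_zero_iff)
qed

lemma separator_zero:
  assumes "q \<in> V" "p \<in> V" "p \<noteq> q" shows "cone_poly p (separator n q) = 0"
proof -
  have "cone_poly p (point_form p) = 0"
    using assms(2) cone_poly_point_form_eq_0_iff by blast
  then show ?thesis
    unfolding separator_def ring_map.map_prod[OF ring_map_cone_poly]
    using finite_affine_vec_triple_points assms by (intro prod_zero) auto
qed

lemma mem_symbolic_power_boroczky_iff:
  "f \<in> symbolic_power J m \<longleftrightarrow> (\<forall>q\<in>V. \<exists>s. cone_poly q s \<noteq> 0 \<and> s * f \<in> ideal_power J m)"
  by (rule mem_symbolic_power_iff[where h = "separator n", OF ring_map_cone_poly finite_affine_vec_triple_points homogeneous_ideal_boroczky separator_nonzero separator_zero])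

section \<open>Lower bound: the degree of forms in the symbolic powers\<close>

lemma incident_iff:
  assumes "\<zeta> \<in> unity_roots n"
  shows "incident \<zeta> u \<longleftrightarrow> cnj u = (inverse \<zeta> - \<zeta> ^ 2) + \<zeta> * u"
proof -
  have "\<zeta> \<noteq> 0" using unity_roots_nonzero[of n \<zeta>] assms n by simp
  then have inv: "\<zeta> * inverse \<zeta> = 1" by simp
  \<comment> \<open>Dividing the cubic by \<open>\<zeta>\<close> gives the line with slope
    \<open>\<zeta>\<close> and intercept \<open>inverse \<zeta> - \<zeta> ^ 2\<close>, the shape
    required by the descent.\<close>
  have "\<zeta> ^ 3 - u * \<zeta> ^ 2 + cnj u * \<zeta> - 1 = \<zeta> * (cnj u - ((inverse \<zeta> - \<zeta> ^ 2) + \<zeta> * u))"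
    using inv by algebra
  then show ?thesis using \<open>\<zeta> \<noteq> 0\<close> by (auto simp: incident_def)
qed

text \<open>For a well chosen scale the multipliers \<open>s q\<close> are nonzero at the triple
  points in the chart \<open>z = c\<close>, so \<open>f\<close> itself has multiplicity at least
  \<open>m\<close> there. The descent would make \<open>f\<close> vanish on the whole chart, against
  the choice of \<open>v\<close>.\<close>

lemma total_degree_symbolic_power_ge:
  assumes "12 \<le> n" "f \<in> symbolic_power J m" "f \<noteq> 0"
  shows "m * n \<le> 3 * total_degree f"
proof (rule ccontr)
  assume "\<not> ?thesis"
  then have less: "3 * total_degree f < m * n" by simp
  have n0: "0 < n" using n by simp
  obtain s where s: "\<And>q. q \<in> V \<Longrightarrow> cone_poly q (s q) \<noteq> 0"
    "\<And>q. q \<in> V \<Longrightarrow> s q * f \<in> ideal_power J m"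
    using assms(2) unfolding mem_symbolic_power_boroczky_iff by metis
  obtain v where v: "eval_poly f v \<noteq> 0" "v $ 3 \<noteq> 0" "v $ 1 + \<i> * v $ 2 \<noteq> 0"
    using ex_eval_poly_nonzero[OF assms(3)] by blast
  define a where "a = (v $ 1 + \<i> * v $ 2) / v $ 3"
  define b where "b = (v $ 1 - \<i> * v $ 2) / v $ 3"
  have a0: "a \<noteq> 0" using v by (simp add: a_def)
  have "a + b = 2 * v $ 1 / v $ 3" "a - b = 2 * \<i> * v $ 2 / v $ 3"
    by (simp_all add: a_def b_def add_divide_distrib[symmetric] diff_divide_distrib[symmetric])
  then have vab: "v $ 3 *s isotropic_vec a b = v"
    unfolding vec_eq_iff forall_3 isotropic_vec_def vector_3 vector_smult_component
    using v(2) by simp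
  have "poly (cone_poly (isotropic_vec a b) f) (v $ 3) \<noteq> 0"
    using v(1) by (simp add: poly_cone_poly vab)
  then have "cone_poly (isotropic_vec a b) f \<noteq> 0" by auto
  \<comment> \<open>One scale \<open>c\<close> must serve for \<open>f\<close> at \<open>v\<close>
    and for all multipliers: it is a nonroot of a finite product of nonzero polynomials.\<close>
  then have "cone_poly (isotropic_vec a b) f * (\<Prod>q\<in>V. cone_poly q (s q)) \<noteq> 0"
    using s(1) finite_affine_vec_triple_points by (simp add: prod_zero_iff)
  then obtain c where "poly (cone_poly (isotropic_vec a b) f * (\<Prod>q\<in>V. cone_poly q (s q))) c \<noteq> 0"
    using ex_nonroot by blast
  then have c: "eval_poly f (c *s isotropic_vec a b) \<noteq> 0"
    "\<And>q. q \<in> V \<Longrightarrow> eval_poly (s q) (c *s q) \<noteq> 0"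
    using finite_affine_vec_triple_points by (auto simp: poly_prod prod_zero_iff poly_cone_poly)
  define Q where "Q = (\<lambda>p. (complex_of_point p, cnj (complex_of_point p))) ` triple_points n"
  have "blowup 0 0 (dehomogenize c f) = 0"
  proof (rule blowup_eq_0_if_small_degree[where W = "unity_roots n" and Q = Q and n = n and m = m
        and d = "total_degree f" and \<beta> = "\<lambda>\<zeta>. inverse \<zeta> - \<zeta> ^ 2"])
    show "finite (unity_roots n)" "card (unity_roots n) = n" "12 \<le> n" "3 * total_degree f < m * n"
      using finite_unity_roots[OF n0] card_unity_roots[OF n0] assms(1) less by auto
    show "finite Q" using finite_triple_points[OF n0 n] by (simp add: Q_def)
    show "degree (blowup a b (dehomogenize c f)) \<le> total_degree f" for a b
      by (rule degree_blowup_dehomogenize_le)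
  next
    fix a b assume "(a, b) \<in> Q"
    then obtain p where p: "p \<in> triple_points n" "a = complex_of_point p" "b = cnj (complex_of_point p)"
      by (auto simp: Q_def)
    have "{\<zeta> \<in> unity_roots n. b = inverse \<zeta> - \<zeta> ^ 2 + \<zeta> * a}
        = {\<zeta> \<in> unity_roots n. incident \<zeta> (complex_of_point p)}"
      using incident_iff[of _ "complex_of_point p"] by (auto simp: p)
    then show "card {\<zeta> \<in> unity_roots n. b = inverse \<zeta> - \<zeta> ^ 2 + \<zeta> * a} \<le> 3"
      using p(1) by (simp add: triple_points_eq[OF n0 n])
    have q: "isotropic_vec a b = affine_vec p" "affine_vec p \<in> V"
      using p by (simp_all add: affine_vec_def)
    let ?B = "\<lambda>f. blowup a b (dehomogenize c f)"
    interpret B: ring_map ?B by (rule ring_map_blowup_dehomogenize)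
    have "[:0, 1:] ^ m dvd ?B (s (affine_vec p) * f)"
    proof (rule ideal_power_dvd[OF B.ring_map_axioms])
      fix j assume "j \<in> J"
      then have "cone_poly (affine_vec p) j = 0" using q(2) unfolding homogeneous_ideal_boroczky by blast
      then have "eval_poly j (c *s affine_vec p) = 0" using poly_cone_poly[of "affine_vec p" j c] by simp
      then have "poly (?B j) 0 = 0" by (simp add: poly_blowup_dehomogenize_0 q(1))
      then show "[:0, 1:] dvd ?B j" using poly_eq_0_iff_dvd[of "?B j" 0] by simp
    qed (rule s(2)[OF q(2)])
    then have dvd: "[:0, 1:] ^ m dvd ?B (s (affine_vec p)) * ?B f" by (simp add: B.map_mult)
    \<comment> \<open>The multiplier has order 0 in \<open>t\<close>, so the whole power of
      \<open>t\<close> divides the factor coming from \<open>f\<close>.\<close>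
    have "poly (?B (s (affine_vec p))) 0 \<noteq> 0"
      using c(2)[OF q(2)] by (simp add: poly_blowup_dehomogenize_0 q(1))
    then have ord: "?B (s (affine_vec p)) \<noteq> 0" "order 0 (?B (s (affine_vec p))) = 0"
      by (auto intro: order_0I)
    show "[:0, 1:] ^ m dvd ?B f"
    proof (cases "?B f = 0")
      case False
      then show ?thesis
        using dvd ord order_divides[of 0 m "?B (s (affine_vec p)) * ?B f"] order_divides[of 0 m "?B f"]
        by (simp add: order_mult)
    qed simp
  next
    fix \<zeta> assume \<zeta>: "\<zeta> \<in> unity_roots n"
    have "{(a, b) \<in> Q. b = inverse \<zeta> - \<zeta> ^ 2 + \<zeta> * a}
        = (\<lambda>p. (complex_of_point p, cnj (complex_of_point p))) `
          {p \<in> triple_points n. incident \<zeta> (complex_of_point p)}"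
      using incident_iff[OF \<zeta>] by (auto simp: Q_def)
    moreover have "inj_on (\<lambda>p. (complex_of_point p, cnj (complex_of_point p)))
        {p \<in> triple_points n. incident \<zeta> (complex_of_point p)}"
      using inj_complex_of_point by (auto simp: inj_on_def dest: injD)
    ultimately show "n \<le> 2 * card {(a, b) \<in> Q. b = inverse \<zeta> - \<zeta> ^ 2 + \<zeta> * a} + 4"
      using card_triple_points_on_line[OF n0 n \<zeta>] by (simp add: card_image)
  qed
  \<comment> \<open>The parameters \<open>t = a\<close> and \<open>w = b / a\<close> reach
    \<open>(a, b)\<close> from the origin; this is why \<open>a \<noteq> 0\<close> was
    arranged.\<close>
  then have "eval_poly f (c *s isotropic_vec a b) = 0"
    using poly_blowup_dehomogenize[of 0 0 c f a "b / a"] a0 by simp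
  then show False using c(1) by simp
qed

section \<open>Upper bound: powers of the product of all lines\<close>

definition line_form :: "complex \<Rightarrow> (3, complex) polynomial" where
  "line_form \<zeta> = linear_form (vector [1 - \<zeta>, - \<i> - \<i> * \<zeta>, \<zeta> ^ 2 - inverse \<zeta>])"

text \<open>With \<open>u = x + \<i> * y\<close> and \<open>v = x - \<i> * y\<close> the form
  becomes \<open>v - \<zeta> * u - (inverse \<zeta> - \<zeta> ^ 2)\<close> in the chart
  \<open>z = 1\<close>, which is monic in \<open>v\<close>.\<close>

lemma line_form_nonzero: "dehomogenize 1 (line_form \<zeta>) \<noteq> 0"
proof -
  have "dehomogenize 1 (line_form \<zeta>) = [:- [:inverse \<zeta> - \<zeta> ^ 2, \<zeta>:], 1:]"
    unfolding dehomogenize_def line_form_def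
    by (subst subst_linear_form[OF ring_map_const_poly2])
      (simp add: sum_3 isotropic_coords_def vector_3 pCons_one[symmetric] field_simps)
  then show ?thesis by simp
qed

lemma cone_poly_line_form:
  assumes "\<zeta> \<in> unity_roots n" "incident \<zeta> (complex_of_point p)"
  shows "cone_poly (affine_vec p) (line_form \<zeta>) = 0"
proof -
  define u v where "u = complex_of_point p" and "v = cnj u"
  define s d where "s = (u + v) / 2" and "d = (u - v) / 2"
  have v: "v = (inverse \<zeta> - \<zeta> ^ 2) + \<zeta> * u"
    using assms incident_iff by (simp add: u_def v_def)
  have uv: "u = s + d" "v = s - d" by (simp_all add: s_def d_def field_simps)
  have "affine_vec p = vector [s, - \<i> * d, 1]"
    by (simp add: affine_vec_def isotropic_vec_def s_def d_def u_def v_def)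
  moreover have "(1 - \<zeta>) * s + (- \<i> - \<i> * \<zeta>) * (- \<i> * d) + (\<zeta> ^ 2 - inverse \<zeta>) = 0"
    using v uv i_squared by algebra
  ultimately show ?thesis
    by (simp only: line_form_def cone_poly_linear_form vector_3 mult_1_right) simp
qed

lemma prod_triple:
  fixes g :: "'b \<Rightarrow> 'c::comm_monoid_mult"
  assumes "a \<noteq> b" "a \<noteq> c" "b \<noteq> c" shows "prod g {a, b, c} = g a * g b * g c"
  using assms by (simp add: mult.assoc)

text \<open>At a triple point \<open>q\<close>, each of its three lines times the separator of
  \<open>q\<close> lies in the ideal. Hence the multiplier \<open>(separator n q ^ 3) ^ k\<close>,
  which is nonzero at \<open>q\<close>, moves the \<open>k\<close>-th power of the product into the
  ideal power of exponent \<open>3 * k\<close>; the other lines are absorbed.\<close>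

lemma prod_line_forms_mem_symbolic_power:
  assumes "m \<le> 3 * k"
  shows "(\<Prod>\<zeta>\<in>unity_roots n. line_form \<zeta>) ^ k \<in> symbolic_power J m"
  unfolding mem_symbolic_power_boroczky_iff
proof
  fix q assume "q \<in> V"
  then obtain p where p: "p \<in> triple_points n" "q = affine_vec p" by blast
  have n0: "0 < n" using n by simp
  let ?h = "separator n q" and ?L = line_form
  have "card {\<zeta> \<in> unity_roots n. incident \<zeta> (complex_of_point p)} = 3"
    using p(1) by (simp add: triple_points_eq[OF n0 n])
  then obtain \<alpha> \<beta> \<gamma> where abc: "{\<zeta> \<in> unity_roots n. incident \<zeta> (complex_of_point p)} = {\<alpha>, \<beta>, \<gamma>}"
    "\<alpha> \<noteq> \<beta>" "\<alpha> \<noteq> \<gamma>" "\<beta> \<noteq> \<gamma>"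
    unfolding card_3_iff by blast
  have "{\<alpha>, \<beta>, \<gamma>} \<subseteq> unity_roots n" using abc(1) by blast
  then have "(\<Prod>\<zeta>\<in>unity_roots n. ?L \<zeta>) = (\<Prod>\<zeta>\<in>unity_roots n - {\<alpha>, \<beta>, \<gamma>}. ?L \<zeta>) * (\<Prod>\<zeta>\<in>{\<alpha>, \<beta>, \<gamma>}. ?L \<zeta>)"
    using finite_unity_roots[OF n0] by (intro prod.subset_diff) auto
  moreover define R where "R = (\<Prod>\<zeta>\<in>unity_roots n - {\<alpha>, \<beta>, \<gamma>}. ?L \<zeta>)"
  moreover have "(\<Prod>\<zeta>\<in>{\<alpha>, \<beta>, \<gamma>}. ?L \<zeta>) = ?L \<alpha> * ?L \<beta> * ?L \<gamma>"
    using abc(2-4) by (rule prod_triple)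
  ultimately have R: "(\<Prod>\<zeta>\<in>unity_roots n. ?L \<zeta>) = R * (?L \<alpha> * ?L \<beta> * ?L \<gamma>)"
    by (simp only:)
  have J: "?h * ?L \<zeta> \<in> J" if "\<zeta> \<in> {\<alpha>, \<beta>, \<gamma>}" for \<zeta>
  proof -
    have "\<zeta> \<in> unity_roots n" "incident \<zeta> (complex_of_point p)" using that abc(1) by blast+
    then have "cone_poly q (?L \<zeta>) = 0" unfolding p(2) by (rule cone_poly_line_form)
    then have "cone_poly r (?h * ?L \<zeta>) = 0" if "r \<in> V" for r
      using separator_zero[OF \<open>q \<in> V\<close> that] by (auto simp: ring_map.map_mult[OF ring_map_cone_poly])
    then show ?thesis unfolding homogeneous_ideal_boroczky by blast
  qed
  have "(?h * ?L \<alpha> * (?h * ?L \<beta>) * (?h * ?L \<gamma>)) ^ k \<in> ideal_power J m"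
    by (rule subsetD[OF ideal_power_antimono[OF assms]], rule power_mem_ideal_power) (rule J, blast)+
  then have "R ^ k * (?h * ?L \<alpha> * (?h * ?L \<beta>) * (?h * ?L \<gamma>)) ^ k \<in> ideal_power J m"
    by (rule ideal_absorbs[OF is_ideal_power])
  also have "R ^ k * (?h * ?L \<alpha> * (?h * ?L \<beta>) * (?h * ?L \<gamma>)) ^ k = (?h ^ 3) ^ k * (\<Prod>\<zeta>\<in>unity_roots n. ?L \<zeta>) ^ k"
    unfolding R power_mult_distrib[symmetric] by (simp only: power3_eq_cube mult_ac)
  finally have "(?h ^ 3) ^ k * (\<Prod>\<zeta>\<in>unity_roots n. ?L \<zeta>) ^ k \<in> ideal_power J m" .
  moreover have "cone_poly q ((?h ^ 3) ^ k) \<noteq> 0"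
    using separator_nonzero[OF \<open>q \<in> V\<close>] by (simp add: ring_map.map_power[OF ring_map_cone_poly])
  ultimately show "\<exists>s. cone_poly q s \<noteq> 0 \<and> s * (\<Prod>\<zeta>\<in>unity_roots n. ?L \<zeta>) ^ k \<in> ideal_power J m"
    by blast
qed

lemma prod_line_forms_nonzero: "(\<Prod>\<zeta>\<in>unity_roots n. line_form \<zeta>) ^ k \<noteq> 0"
proof -
  interpret ring_map "dehomogenize 1" by (rule ring_map_dehomogenize)
  have "dehomogenize 1 ((\<Prod>\<zeta>\<in>unity_roots n. line_form \<zeta>) ^ k) \<noteq> 0"
    unfolding map_power map_prod using line_form_nonzero finite_unity_roots[of n] n
    by (simp add: prod_zero_iff)
  then show ?thesis using map_zero by metis
qed

lemma total_degree_prod_line_forms: "total_degree ((\<Prod>\<zeta>\<in>unity_roots n. line_form \<zeta>) ^ k) \<le> n * k"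
proof (induction k)
  case (Suc k)
  have "total_degree (\<Prod>\<zeta>\<in>unity_roots n. line_form \<zeta>) \<le> (\<Sum>\<zeta>\<in>unity_roots n. total_degree (line_form \<zeta>))"
    by (rule total_degree_prod_le)
  also have "\<dots> \<le> (\<Sum>\<zeta>\<in>unity_roots n. 1)"
    unfolding line_form_def by (intro sum_mono total_degree_linear_form)
  also have "\<dots> = n" using card_unity_roots[of n] n by simp
  finally have "total_degree (\<Prod>\<zeta>\<in>unity_roots n. line_form \<zeta>) \<le> n" .
  then show ?case
    using Suc total_degree_mult_le[of "\<Prod>\<zeta>\<in>unity_roots n. line_form \<zeta>" "(\<Prod>\<zeta>\<in>unity_roots n. line_form \<zeta>) ^ k"]
    by simp
qed simp

section \<open>Bounds for the initial degrees and their limit\<close>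

lemma initial_degree_symbolic_power_bounds:
  assumes "12 \<le> n"
  shows "m * n \<le> 3 * initial_degree (symbolic_power J m)"
    and "3 * initial_degree (symbolic_power J m) \<le> n * (m + 2)"
proof -
  \<comment> \<open>The ceiling of \<open>m / 3\<close>, the least exponent for which the product of
    lines reaches multiplicity \<open>m\<close>; rounding up costs at most 2 in
    \<open>3 * k\<close>.\<close>
  define k where "k = (m + 2) div 3"
  define f where "f = (\<Prod>\<zeta>\<in>unity_roots n. line_form \<zeta>) ^ k"
  have "m \<le> 3 * k" "3 * k \<le> m + 2" unfolding k_def by presburger+
  then have f: "f \<in> symbolic_power J m"
    unfolding f_def by (intro prod_line_forms_mem_symbolic_power)
  have f0: "f \<noteq> 0" unfolding f_def by (rule prod_line_forms_nonzero)
  have deg: "total_degree f \<le> n * k" unfolding f_def by (rule total_degree_prod_line_forms)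
  \<comment> \<open>The nonzero element \<open>f\<close> guarantees that the \<open>LEAST\<close> in
    \<open>initial_degree\<close> is attained, so the lower bound applies to a minimizer.\<close>
  have "\<exists>g\<in>symbolic_power J m. g \<noteq> 0 \<and> total_degree g = initial_degree (symbolic_power J m)"
    unfolding initial_degree_def by (rule LeastI[of _ "total_degree f"]) (use f f0 in blast)
  then show "m * n \<le> 3 * initial_degree (symbolic_power J m)"
    using total_degree_symbolic_power_ge[OF assms] by metis
  have "initial_degree (symbolic_power J m) \<le> total_degree f"
    unfolding initial_degree_def by (rule Least_le) (use f f0 in blast)
  then have "initial_degree (symbolic_power J m) \<le> n * k" using deg by simp
  then have "3 * initial_degree (symbolic_power J m) \<le> n * (3 * k)" by simp
  also have "\<dots> \<le> n * (m + 2)" using \<open>3 * k \<le> m + 2\<close> by (rule mult_left_mono) simp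
  finally show "3 * initial_degree (symbolic_power J m) \<le> n * (m + 2)" .
qed

end

theorem theorem4p3:
  fixes n :: nat
  assumes "n \<ge> 12" and "6 dvd n"
  shows "waldschmidt_constant (homogeneous_ideal (boroczky_triple_points n)) = real n / 3"
proof -
  define d where "d m = initial_degree (symbolic_power (homogeneous_ideal (boroczky_triple_points n)) m)" for m
  have "3 \<le> n" using assms(1) by simp
  note bounds = initial_degree_symbolic_power_bounds[OF this assms(1), folded d_def]
  have lower: "real n / 3 \<le> real (d m) / real m" if "0 < m" for m
  proof -
    have "real m * real n \<le> 3 * real (d m)"
      using bounds(1)[of m] by (metis of_nat_le_iff of_nat_mult of_nat_numeral)
    then show ?thesis using that by (simp add: field_simps)
  qed
  have upper: "real (d m) / real m \<le> real n / 3 + (2 * real n / 3) / real m" if "0 < m" for m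
  proof -
    have "real (3 * d m) \<le> real (n * (m + 2))" using bounds(2)[of m] by (rule of_nat_mono)
    then have "real (d m) \<le> (real n * real m + 2 * real n) / 3" by (simp add: algebra_simps)
    also have "\<dots> = (real n / 3 + (2 * real n / 3) / real m) * real m"
      using that by (simp add: distrib_right add_divide_distrib)
    finally show ?thesis using that by (simp add: pos_divide_le_eq)
  qed
  have "(\<lambda>m. real n / 3 + (2 * real n / 3) / real m) \<longlonglongrightarrow> real n / 3 + 0"
    by (intro tendsto_intros lim_const_over_n)
  \<comment> \<open>The gap between the two bounds is the rounding error
    \<open>2 * n / (3 * m)\<close>; the comparison starts at \<open>m = 1\<close>, away from the
    division by 0.\<close>
  then have "(\<lambda>m. real (d m) / real m) \<longlonglongrightarrow> real n / 3"
    using lower upper by (intro tendsto_sandwich[of "\<lambda>_. real n / 3" "\<lambda>m. real (d m) / real m" sequentially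
        "\<lambda>m. real n / 3 + (2 * real n / 3) / real m"])
      (auto intro!: eventually_sequentiallyI[of 1])
  then show ?thesis unfolding waldschmidt_constant_def d_def by (rule limI)
qed

end
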